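(* Let $k\in\mathbb N$, $q\in[1,\infty)$, and $X$ and $Y$ be ball Banach function spaces. Assume that $X^{\frac1q}$ and $Y^{\frac1q}$ are ball Banach function spaces and that the centered ball average operators $\{\mathcal B_r\}_{r\in(0,\infty)}$ are uniformly bounded on $X^{\frac1q}$ and $Y^{\frac1q}$. Then there exists a positive constant $C$ such that, for any $f\in[\bigcup_{\sigma\in(0,k)}F^{\sigma,k}_{X,q}]\cap[\bigcup_{\sigma\in(0,k)}F^{\sigma,k}_{Y,q}]$ with compact support, $$\left(\frac1{kq}\left|\mathbb S^{n-1}\right|\right)^{\frac1q}\|f\|_X\le\liminf_{s\to0^+}s^{\frac1q}\left\|\mathfrak D^{s,k}_q(f)\right\|_{X^{1-s}Y^s}\le\limsup_{s\to0^+}s^{\frac1q}\left\|\mathfrak D^{s,k}_q(f)\right\|_{X^{1-s}Y^s}\le C\|f\|_X,$$ where $C$ is independent of $f$.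
   Context: All functions are real-valued measurable functions on $\mathbb R^n$; $L^0$ is the set of all of them. $\Delta_h^kf(x):=\sum_{j=0}^k(-1)^{k-j}\binom kj f(x+jh)$ and, for $s\in(0,1)$, $q\in[1,\infty)$, $\mathfrak D^{s,k}_q(f)(x):=[\int_{\mathbb R^n}\frac{|\Delta_h^kf(x)|^q}{|h|^{n+skq}}\,dh]^{1/q}$. $|\mathbb S^{n-1}|$ is the surface measure of the unit sphere. A ball Banach function (BBF) space is a Banach space $X\subset L^0$ with norm $\|\cdot\|_X$ defined (with values in $[0,\infty]$) on all of $L^0$ such that: (a) $\|f\|_X=0$ implies $f=0$ a.e.; (b) $|g|\le|f|$ a.e. implies $\|g\|_X\le\|f\|_X$; (c) $0\le f_m\uparrow f$ a.e. implies $\|f_m\|_X\uparrow\|f\|_X$; (d) $\mathbf 1_B\in X$ for every ball $B$; (e) for every ball $B$ there is $C_{(B)}>0$ with $\int_B|f|\le C_{(B)}\|f\|_X$ for all $f\in X$. For $p\in(0,\infty)$, the $p$-convexification is $X^p:=\{f\in L^0:|f|^p\in X\}$ with $\|f\|_{X^p}:=\||f|^p\|_X^{1/p}$. For $s\in(0,1)$, the Calderón–Lozanovskiĭ space $X^{1-s}Y^s$ is the set of $h\in L^0$ with $|h|\le|f|^{1-s}|g|^s$ for some $f\in X$, $g\in Y$, with norm $\|h\|_{X^{1-s}Y^s}:=\inf\{\|f\|_X^{1-s}\|g\|_Y^s:|h|\le|f|^{1-s}|g|^s\}$. $\mathcal B_r(f)(x):=\frac1{|B(x,r)|}\int_{B(x,r)}|f(y)|\,dy$.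 For $\sigma\in(0,k)$, $F^{\sigma,k}_{X,q}$ is the set of all $f\in X$ with $$\|f\|_{F^{\sigma,k}_{X,q}}:=\|f\|_X+\left\|\left[\int_{\mathbb R^n}\frac{|\Delta_h^kf(\cdot)|^q}{|h|^{n+\sigma q}}\,dh\right]^{\frac1q}\right\|_X<\infty.$$ *)

theory Defs
  imports "HOL-Analysis.Analysis"
begin

text \<open>The space \<open>\<real>\<^sup>n\<close> is an arbitrary Euclidean space, \<open>n = DIM('a)\<close>. Functions are real-valued and
  Lebesgue measurable; functions that agree almost everywhere are identified, so every pointwise
  relation between functions is required almost everywhere only.\<close>

definition L0 :: "('a::euclidean_space \<Rightarrow> real) set" where
  "L0 = borel_measurable lebesgue"

text \<open>A (candidate) norm is a \<open>[0,\<infinity>]\<close>-valued functional; only its values on \<^const>\<open>L0\<close> matter.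
  The space it determines consists of the functions of finite norm.\<close>

type_synonym 'a fnorm = "('a \<Rightarrow> real) \<Rightarrow> ennreal"

definition fspace :: "('a::euclidean_space) fnorm \<Rightarrow> ('a \<Rightarrow> real) set" where
  "fspace N = {f \<in> L0. N f < \<infinity>}"

text \<open>Real powers on \<open>[0,\<infinity>]\<close>, used with a positive exponent only.\<close>

definition epowr :: "ennreal \<Rightarrow> real \<Rightarrow> ennreal" where
  "epowr x p = (if x = \<infinity> then \<infinity> else ennreal (enn2real x powr p))"

locale ball_banach_function_space =
  fixes N :: "('a::euclidean_space) fnorm"
  assumes norm_add: "\<And>f g. f \<in> fspace N \<Longrightarrow> g \<in> fspace N \<Longrightarrow> N (\<lambda>x. f x + g x) \<le> N f + N g"
    and norm_scale: "\<And>f c. f \<in> fspace N \<Longrightarrow> N (\<lambda>x. c * f x) = ennreal \<bar>c\<bar> * N f"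
    and complete: "\<And>F :: nat \<Rightarrow> 'a \<Rightarrow> real.
      (\<And>m. F m \<in> fspace N) \<Longrightarrow>
      (\<And>e::real. e > 0 \<Longrightarrow> \<exists>M. \<forall>m\<ge>M. \<forall>l\<ge>M. N (\<lambda>x. F m x - F l x) < ennreal e) \<Longrightarrow>
      \<exists>f\<in>fspace N. (\<lambda>m. N (\<lambda>x. F m x - f x)) \<longlonglongrightarrow> 0"
    and norm_zero: "\<And>f. f \<in> L0 \<Longrightarrow> N f = 0 \<Longrightarrow> AE x in lebesgue. f x = 0"
    and norm_mono: "\<And>f g. f \<in> L0 \<Longrightarrow> g \<in> L0 \<Longrightarrow>
      (AE x in lebesgue. \<bar>g x\<bar> \<le> \<bar>f x\<bar>) \<Longrightarrow> N g \<le> N f"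
    and norm_Fatou: "\<And>(F :: nat \<Rightarrow> 'a \<Rightarrow> real) f. (\<And>m. F m \<in> L0) \<Longrightarrow> f \<in> L0 \<Longrightarrow>
      (AE x in lebesgue. (\<forall>m. 0 \<le> F m x) \<and> incseq (\<lambda>m. F m x) \<and> (\<lambda>m. F m x) \<longlonglongrightarrow> f x) \<Longrightarrow>
      incseq (\<lambda>m. N (F m)) \<and> (\<lambda>m. N (F m)) \<longlonglongrightarrow> N f"
    and ball_mem: "\<And>(a::'a) r. r > 0 \<Longrightarrow> indicator (ball a r) \<in> fspace N"
    and locally_integrable: "\<And>(a::'a) r. r > 0 \<Longrightarrow>
      \<exists>C::real. C > 0 \<and> (\<forall>f\<in>fspace N.
        (\<integral>\<^sup>+x\<in>ball a r. ennreal \<bar>f x\<bar> \<partial>lebesgue) \<le> ennreal C * N f)"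

text \<open>The norm of a measurable \<open>[0,\<infinity>]\<close>-valued function: it is \<open>\<infinity>\<close> unless the function is finite almost
  everywhere, i.e. unless the function represents an element of \<^const>\<open>L0\<close>.\<close>

definition ext_norm :: "('a::euclidean_space) fnorm \<Rightarrow> ('a \<Rightarrow> ennreal) \<Rightarrow> ennreal" where
  "ext_norm N G =
     (if AE x in lebesgue. G x < \<infinity> then N (\<lambda>x. enn2real (G x)) else \<infinity>)"

definition convexification :: "real \<Rightarrow> ('a::euclidean_space) fnorm \<Rightarrow> 'a fnorm" where
  "convexification p N = (\<lambda>f. epowr (N (\<lambda>x. \<bar>f x\<bar> powr p)) (1 / p))"

text \<open>The norm of \<open>X\<^sup>1\<^sup>-\<^sup>s Y\<^sup>s\<close>; the infimum of the empty set is \<open>\<infinity>\<close>.\<close>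

definition calderon_lozanovskii ::
  "real \<Rightarrow> ('a::euclidean_space) fnorm \<Rightarrow> 'a fnorm \<Rightarrow> 'a fnorm" where
  "calderon_lozanovskii s NX NY = (\<lambda>h.
     Inf {epowr (NX f) (1 - s) * epowr (NY g) s | f g.
       f \<in> fspace NX \<and> g \<in> fspace NY \<and>
       (AE x in lebesgue. \<bar>h x\<bar> \<le> \<bar>f x\<bar> powr (1 - s) * \<bar>g x\<bar> powr s)})"

definition ball_average ::
  "real \<Rightarrow> ('a::euclidean_space \<Rightarrow> real) \<Rightarrow> 'a \<Rightarrow> ennreal" where
  "ball_average r f x =
     (\<integral>\<^sup>+y\<in>ball x r. ennreal \<bar>f y\<bar> \<partial>lebesgue) / emeasure lebesgue (ball x r)"

definition ball_averages_uniformly_bounded :: "('a::euclidean_space) fnorm \<Rightarrow> bool" where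
  "ball_averages_uniformly_bounded N \<longleftrightarrow>
     (\<exists>C::real. C > 0 \<and>
       (\<forall>r>0. \<forall>f\<in>fspace N. ext_norm N (ball_average r f) \<le> ennreal C * N f))"

definition fdiff :: "nat \<Rightarrow> 'a::euclidean_space \<Rightarrow> ('a \<Rightarrow> real) \<Rightarrow> 'a \<Rightarrow> real" where
  "fdiff k h f x =
     (\<Sum>j=0..k. (- 1) ^ (k - j) * real (k choose j) * f (x + real j *\<^sub>R h))"

text \<open>The inner function in the norm of \<open>F\<close>; in the exponent, \<open>\<sigma>\<close> is the full smoothness.\<close>

definition smoothness_fun ::
  "real \<Rightarrow> nat \<Rightarrow> real \<Rightarrow> ('a::euclidean_space \<Rightarrow> real) \<Rightarrow> 'a \<Rightarrow> ennreal" where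
  "smoothness_fun \<sigma> k q f x =
     epowr (\<integral>\<^sup>+h. ennreal (\<bar>fdiff k h f x\<bar> powr q / norm h powr (real DIM('a) + \<sigma> * q))
              \<partial>lebesgue) (1 / q)"

definition frak_D ::
  "real \<Rightarrow> nat \<Rightarrow> real \<Rightarrow> ('a::euclidean_space \<Rightarrow> real) \<Rightarrow> 'a \<Rightarrow> ennreal" where
  "frak_D s k q f x =
     epowr (\<integral>\<^sup>+h. ennreal (\<bar>fdiff k h f x\<bar> powr q / norm h powr (real DIM('a) + s * real k * q))
              \<partial>lebesgue) (1 / q)"

definition F_norm ::
  "('a::euclidean_space) fnorm \<Rightarrow> real \<Rightarrow> nat \<Rightarrow> real \<Rightarrow> ('a \<Rightarrow> real) \<Rightarrow> ennreal" where
  "F_norm N \<sigma> k q f = N f + ext_norm N (smoothness_fun \<sigma> k q f)"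

definition F_space ::
  "('a::euclidean_space) fnorm \<Rightarrow> real \<Rightarrow> nat \<Rightarrow> real \<Rightarrow> ('a \<Rightarrow> real) set" where
  "F_space N \<sigma> k q = {f \<in> fspace N. F_norm N \<sigma> k q f < \<infinity>}"

text \<open>Compact support in the almost everywhere sense, independent of the representative.\<close>

definition compactly_supported :: "('a::euclidean_space \<Rightarrow> real) \<Rightarrow> bool" where
  "compactly_supported f \<longleftrightarrow> (\<exists>K. compact K \<and> (AE x in lebesgue. x \<notin> K \<longrightarrow> f x = 0))"

text \<open>Surface measure of a subset \<open>A\<close> of the unit sphere, normalised as in polar coordinates:
  \<open>n\<close> times the volume of the cone over \<open>A\<close>. For \<open>n = 1\<close> it is the counting measure.\<close>

definition sphere_measure :: "('a::euclidean_space) set \<Rightarrow> real" where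
  "sphere_measure A =
     real DIM('a) * measure lebesgue {t *\<^sub>R \<theta> | t \<theta>. 0 < t \<and> t \<le> 1 \<and> \<theta> \<in> A}"

end

theory Submission
  imports Defs
begin

text \<open>Let \<open>G s x\<close> be the integral inside \<^const>\<open>frak_D\<close>, so that \<open>frak_D = G\<^sup>1\<^sup>/\<^sup>q\<close> and the \<open>X\<close>-norm of
  \<open>frak_D\<close> is the \<open>1/q\<close>-th power of the norm of \<open>G s\<close> in \<open>X\<^sup>1\<^sup>/\<^sup>q\<close>.

  Upper bound. The part of \<open>G s\<close> over \<open>norm h < 1\<close> is dominated by the integral for a fixed smoothness
  \<open>\<sigma> > s k\<close>, hence vanishes after multiplication by \<open>s\<close>. Over \<open>norm h \<ge> 1\<close> the terms \<open>f (x + j h)\<close>,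
  \<open>j \<ge> 1\<close>, are summed over dyadic shells into a series of ball averages of \<open>\<bar>f\<bar>\<^sup>q\<close> with ratio \<open>2\<^sup>-\<^sup>s\<^sup>k\<^sup>q\<close>,
  whose sum is of order \<open>1/s\<close>. Since \<open>\<parallel>u\<parallel> \<le> \<parallel>u\<parallel>\<^sub>X\<^sup>1\<^sup>-\<^sup>s \<parallel>u\<parallel>\<^sub>Y\<^sup>s\<close> in \<open>X\<^sup>1\<^sup>-\<^sup>s Y\<^sup>s\<close>, the contribution of \<open>Y\<close>
  disappears as \<open>s\<close> tends to \<open>0\<close>.

  Lower bound. If \<open>f\<close> lives on the ball of radius \<open>R\<close>, then \<open>\<bar>\<Delta>\<^sub>h\<^sup>k f\<bar> = \<bar>f\<bar>\<close> there for \<open>norm h \<ge> 2 R\<close>, and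
  integrating \<open>norm h\<close> to the power \<open>-n-skq\<close> over that range gives the stated constant. It remains to
  see that the norm of \<open>f\<close> in \<open>X\<^sup>1\<^sup>-\<^sup>s Y\<^sup>s\<close> is asymptotically at least the norm in \<open>X\<close>.\<close>

section \<open>Function norms with values in the extended half-line\<close>

lemma epowr_ennreal: "0 \<le> r \<Longrightarrow> epowr (ennreal r) p = ennreal (r powr p)"
  by (simp add: epowr_def)

lemma epowr_top [simp]: "epowr top p = top"
  by (simp add: epowr_def)

lemma epowr_zero [simp]: "epowr 0 p = 0"
  by (simp add: epowr_def)

lemma epowr_one_right [simp]: "epowr x 1 = x"
  by (cases x) (auto simp: epowr_ennreal)

lemma epowr_epowr: "epowr (epowr x p) r = epowr x (p * r)"
  by (cases x) (auto simp: epowr_ennreal powr_powr)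

lemma epowr_inverse [simp]: "p \<noteq> 0 \<Longrightarrow> epowr (epowr x p) (1 / p) = x"
  "p \<noteq> 0 \<Longrightarrow> epowr (epowr x (1 / p)) p = x"
  by (simp_all add: epowr_epowr)

lemma epowr_mono: "x \<le> y \<Longrightarrow> 0 \<le> p \<Longrightarrow> epowr x p \<le> epowr y p"
  by (cases x; cases y) (auto simp: epowr_ennreal top_unique intro!: ennreal_leI powr_mono2)

lemma epowr_mult: "0 \<le> c \<Longrightarrow> epowr (ennreal c * x) p = ennreal (c powr p) * epowr x p"
proof (cases x)
  case (real r)
  assume "0 \<le> c"
  with real show ?thesis
    by (simp add: epowr_ennreal powr_mult flip: ennreal_mult)
next
  case top
  assume "0 \<le> c"
  with top show ?thesis
    by (cases "c = 0") (auto simp: ennreal_mult_top)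
qed

lemma epowr_less_top_iff [simp]: "epowr x p < top \<longleftrightarrow> x < top"
  by (cases x) (auto simp: epowr_ennreal)

lemma enn2real_epowr: "x < top \<Longrightarrow> enn2real (epowr x p) = enn2real x powr p"
  by (cases x) (auto simp: epowr_ennreal)

lemma borel_measurable_epowr [measurable]:
  "G \<in> borel_measurable M \<Longrightarrow> (\<lambda>x. epowr (G x) p) \<in> borel_measurable M"
proof -
  assume [measurable]: "G \<in> borel_measurable M"
  have "G -` {\<infinity>} \<inter> space M \<in> sets M" by measurable
  then have [measurable]: "Measurable.pred M (\<lambda>x. G x = \<infinity>)"
    by (simp add: pred_def vimage_def Int_def conj_commute)
  show ?thesis
    unfolding epowr_def by measurable
qed

text \<open>Completeness of Lebesgue measure: preimages of a set under the two functions differ only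
  inside a null set.\<close>

lemma borel_measurable_lebesgue_AE_eq:
  fixes f g :: "'a::euclidean_space \<Rightarrow> 'b::topological_space"
  assumes "f \<in> borel_measurable lebesgue" "AE x in lebesgue. f x = g x"
  shows "g \<in> borel_measurable lebesgue"
proof (rule measurableI)
  fix A :: "'b set" assume A: "A \<in> sets borel"
  have "f -` A \<inter> space lebesgue \<in> sets lebesgue"
    using assms(1) A by (rule measurable_sets)
  moreover have "AE x in lebesgue. x \<in> f -` A \<inter> space lebesgue \<longleftrightarrow> x \<in> g -` A \<inter> space lebesgue"
    using assms(2) by eventually_elim auto
  ultimately show "g -` A \<inter> space lebesgue \<in> sets lebesgue"
    using completion.in_sets_AE by blast
qed auto

section \<open>Calculus of the norm on all of \<open>L0\<close> and of
  \<open>ext_norm\<close>\<close>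

context ball_banach_function_space
begin

lemma norm_cong:
  assumes "f \<in> L0" "g \<in> L0" "AE x in lebesgue. \<bar>f x\<bar> = \<bar>g x\<bar>"
  shows "N f = N g"
  by (rule antisym; rule norm_mono) (use assms in \<open>auto elim: eventually_mono\<close>)

text \<open>Homogeneity with factor 0, applied to the indicator of a ball, which has finite
  norm.\<close>

lemma norm_const_zero: "N (\<lambda>x. 0) = 0"
  using norm_scale[OF ball_mem[of 1 0], of 0] by simp

lemma norm_add_L0:
  assumes "f \<in> L0" "g \<in> L0"
  shows "N (\<lambda>x. f x + g x) \<le> N f + N g"
proof (cases "N f < \<infinity> \<and> N g < \<infinity>")
  case True
  then show ?thesis using norm_add[of f g] assms by (auto simp: fspace_def)
next
  case False
  then show ?thesis by (auto simp: less_top[symmetric])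
qed

text \<open>The axiom \<open>norm_scale\<close> covers finite norms only. An infinite norm stays
  infinite, since a finite norm of \<open>c * f\<close> could be scaled back by
  \<open>1 / c\<close>.\<close>

lemma norm_scale_L0:
  assumes "f \<in> L0" "c > 0"
  shows "N (\<lambda>x. c * f x) = ennreal c * N f"
proof (cases "N f < \<infinity>")
  case True
  then show ?thesis using norm_scale[of f c] assms by (auto simp: fspace_def)
next
  case False
  have "\<not> N (\<lambda>x. c * f x) < \<infinity>"
  proof
    assume "N (\<lambda>x. c * f x) < \<infinity>"
    then have "(\<lambda>x. c * f x) \<in> fspace N"
      using assms by (auto simp: fspace_def L0_def)
    from norm_scale[OF this, of "1 / c"] assms
    have "N f = ennreal (1 / c) * N (\<lambda>x. c * f x)"
      by simp
    also have "\<dots> < \<infinity>"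
      using \<open>N (\<lambda>x. c * f x) < \<infinity>\<close> by (simp add: ennreal_mult_less_top)
    finally show False using False by simp
  qed
  then show ?thesis
    using False \<open>c > 0\<close> by (simp add: less_top[symmetric] ennreal_mult_top)
qed

lemma ext_norm_mono:
  assumes "G \<in> borel_measurable lebesgue" "H \<in> borel_measurable lebesgue"
    and le: "AE x in lebesgue. G x \<le> H x"
  shows "ext_norm N G \<le> ext_norm N H"
proof (cases "AE x in lebesgue. H x < \<infinity>")
  case True
  with le have "AE x in lebesgue. G x < \<infinity>"
    by eventually_elim (rule le_less_trans)
  moreover have "N (\<lambda>x. enn2real (G x)) \<le> N (\<lambda>x. enn2real (H x))"
  proof (rule norm_mono)
    show "AE x in lebesgue. \<bar>enn2real (G x)\<bar> \<le> \<bar>enn2real (H x)\<bar>"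
      using True le by eventually_elim (auto intro: enn2real_mono)
  qed (use assms in \<open>auto simp: L0_def\<close>)
  ultimately show ?thesis using True by (simp add: ext_norm_def)
qed (simp add: ext_norm_def)

lemma ext_norm_cong:
  assumes "G \<in> borel_measurable lebesgue" "H \<in> borel_measurable lebesgue"
    and "AE x in lebesgue. G x = H x"
  shows "ext_norm N G = ext_norm N H"
  by (rule antisym; rule ext_norm_mono) (use assms in \<open>auto elim: eventually_mono\<close>)

lemma ext_norm_ennreal:
  assumes "f \<in> L0"
  shows "ext_norm N (\<lambda>x. ennreal \<bar>f x\<bar>) = N f"
proof -
  have "N (\<lambda>x. \<bar>f x\<bar>) = N f"
    by (rule norm_cong) (use assms in \<open>auto simp: L0_def\<close>)
  then show ?thesis by (simp add: ext_norm_def)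
qed

lemma ext_norm_finite_AE: "ext_norm N G < \<infinity> \<Longrightarrow> AE x in lebesgue. G x < \<infinity>"
  by (auto simp: ext_norm_def split: if_splits)

lemma ext_norm_add:
  assumes [measurable]: "G \<in> borel_measurable lebesgue" "H \<in> borel_measurable lebesgue"
  shows "ext_norm N (\<lambda>x. G x + H x) \<le> ext_norm N G + ext_norm N H"
proof (cases "(AE x in lebesgue. G x < \<infinity>) \<and> (AE x in lebesgue. H x < \<infinity>)")
  case True
  then have G: "AE x in lebesgue. G x < \<infinity>" and H: "AE x in lebesgue. H x < \<infinity>" by auto
  then have fin: "AE x in lebesgue. G x + H x < \<infinity>"
    by eventually_elim simp
  have "N (\<lambda>x. enn2real (G x + H x)) = N (\<lambda>x. enn2real (G x) + enn2real (H x))"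
    by (rule norm_cong)
      (use G H in \<open>auto simp: L0_def enn2real_plus elim: eventually_elim2\<close>)
  also have "\<dots> \<le> N (\<lambda>x. enn2real (G x)) + N (\<lambda>x. enn2real (H x))"
    by (rule norm_add_L0) (auto simp: L0_def)
  finally show ?thesis using G H fin by (simp add: ext_norm_def)
qed (auto simp: ext_norm_def)

lemma ext_norm_zero: "ext_norm N (\<lambda>x. 0) = 0"
  by (simp add: ext_norm_def norm_const_zero)

lemma ext_norm_cmult:
  assumes [measurable]: "G \<in> borel_measurable lebesgue" and "c > 0"
  shows "ext_norm N (\<lambda>x. ennreal c * G x) = ennreal c * ext_norm N G"
proof -
  have "ennreal c * G x < \<infinity> \<longleftrightarrow> G x < \<infinity>" for x
    using \<open>c > 0\<close> by (auto simp: ennreal_mult_less_top)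
  then show ?thesis
    using \<open>c > 0\<close> norm_scale_L0[of "\<lambda>x. enn2real (G x)" c]
    by (simp add: ext_norm_def enn2real_mult L0_def ennreal_mult_top)
qed

lemma ext_norm_sum:
  assumes "finite A" "\<And>i. i \<in> A \<Longrightarrow> G i \<in> borel_measurable lebesgue"
  shows "ext_norm N (\<lambda>x. \<Sum>i\<in>A. G i x) \<le> (\<Sum>i\<in>A. ext_norm N (G i))"
  using assms
proof (induction A rule: finite_induct)
  case empty
  then show ?case by (simp add: ext_norm_zero)
next
  case (insert i A)
  have "ext_norm N (\<lambda>x. G i x + (\<Sum>i\<in>A. G i x)) \<le> ext_norm N (G i) + ext_norm N (\<lambda>x. \<Sum>i\<in>A. G i x)"
    by (rule ext_norm_add) (use insert.prems in auto)
  also have "\<dots> \<le> ext_norm N (G i) + (\<Sum>i\<in>A. ext_norm N (G i))"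
    using insert by (intro add_left_mono) auto
  finally show ?case using insert.hyps by simp
qed

text \<open>Local integrability is what makes the supremum finite almost everywhere, so that the Fatou
  property applies.\<close>

lemma ext_norm_SUP_le:
  assumes [measurable]: "\<And>i. G i \<in> borel_measurable lebesgue"
    and mono: "incseq G" and bound: "\<And>i. ext_norm N (G i) \<le> K" and "K < \<infinity>"
  shows "ext_norm N (\<lambda>x. SUP i. G i x) \<le> K"
proof -
  have "AE x in lebesgue. \<forall>i. G i x < \<infinity>"
    unfolding AE_all_countable
    using le_less_trans[OF bound \<open>K < \<infinity>\<close>] by (intro allI ext_norm_finite_AE) auto
  then have eq: "AE x in lebesgue. \<forall>i. ennreal (enn2real (G i x)) = G i x"
    by eventually_elim (simp add: less_top)
  have bd: "N (\<lambda>x. enn2real (G i x)) \<le> K" for i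
    using bound[of i] \<open>K < \<infinity>\<close> by (auto simp: ext_norm_def split: if_splits)
  \<comment> \<open>On each ball, monotone convergence and local integrability bound the integral of
    the supremum by \<open>C * K\<close>; countably many balls exhaust the space.\<close>
  have "AE x in lebesgue. x \<in> ball 0 r \<longrightarrow> (SUP i. G i x) < \<infinity>" if r: "r > 0" for r
  proof -
    have [measurable]: "ball 0 r \<in> sets lebesgue" by simp
    obtain C :: real where C: "C > 0" "\<And>f. f \<in> fspace N \<Longrightarrow>
        (\<integral>\<^sup>+x\<in>ball 0 r. ennreal \<bar>f x\<bar> \<partial>lebesgue) \<le> ennreal C * N f"
      using locally_integrable[OF r, of 0] by blast
    have "(\<integral>\<^sup>+x\<in>ball 0 r. (SUP i. G i x) \<partial>lebesgue)
        = (\<integral>\<^sup>+x. (SUP i. G i x * indicator (ball 0 r) x) \<partial>lebesgue)"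
      by (simp add: SUP_mult_right_ennreal)
    also have "\<dots> = (SUP i. \<integral>\<^sup>+x\<in>ball 0 r. G i x \<partial>lebesgue)"
      by (rule nn_integral_monotone_convergence_SUP)
        (use mono in \<open>auto simp: incseq_def le_fun_def intro!: mult_right_mono\<close>)
    also have "\<dots> \<le> ennreal C * K"
    proof (rule SUP_least)
      fix i
      have "(\<integral>\<^sup>+x\<in>ball 0 r. G i x \<partial>lebesgue)
          = (\<integral>\<^sup>+x\<in>ball 0 r. ennreal \<bar>enn2real (G i x)\<bar> \<partial>lebesgue)"
        using eq by (intro nn_integral_cong_AE) (auto elim: eventually_mono)
      also have "\<dots> \<le> ennreal C * N (\<lambda>x. enn2real (G i x))"
        using bd[of i] \<open>K < \<infinity>\<close> by (intro C) (auto simp: fspace_def L0_def intro: le_less_trans)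
      also have "\<dots> \<le> ennreal C * K"
        using bd by (intro mult_left_mono) auto
      finally show "(\<integral>\<^sup>+x\<in>ball 0 r. G i x \<partial>lebesgue) \<le> ennreal C * K" .
    qed
    also have "\<dots> < \<infinity>"
      using \<open>K < \<infinity>\<close> by (simp add: ennreal_mult_less_top)
    finally have "AE x in lebesgue. (SUP i. G i x) * indicator (ball 0 r) x \<noteq> \<infinity>"
      by (intro nn_integral_PInf_AE) auto
    then show ?thesis
      by eventually_elim (auto simp: less_top[symmetric])
  qed
  then have "AE x in lebesgue. \<forall>m. x \<in> ball 0 (real (Suc m)) \<longrightarrow> (SUP i. G i x) < \<infinity>"
    unfolding AE_all_countable by auto
  then have fin: "AE x in lebesgue. (SUP i. G i x) < \<infinity>"
  proof eventually_elim
    case (elim x)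
    obtain m where "norm x < real m" using reals_Archimedean2 by blast
    then show ?case using elim[rule_format, of m] by simp
  qed
  have "(\<lambda>i. N (\<lambda>x. enn2real (G i x))) \<longlonglongrightarrow> N (\<lambda>x. enn2real (SUP i. G i x))"
  proof (rule norm_Fatou[THEN conjunct2])
    show "AE x in lebesgue. (\<forall>m. 0 \<le> enn2real (G m x)) \<and> incseq (\<lambda>m. enn2real (G m x)) \<and>
        (\<lambda>m. enn2real (G m x)) \<longlonglongrightarrow> enn2real (SUP i. G i x)"
      using fin
    proof eventually_elim
      case (elim x)
      have le: "G i x \<le> (SUP i. G i x)" for i by (rule SUP_upper) simp
      have inc: "incseq (\<lambda>m. G m x)"
        using mono by (auto simp: incseq_def le_fun_def)
      then have "(\<lambda>m. G m x) \<longlonglongrightarrow> (SUP i. G i x)"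
        by (rule LIMSEQ_SUP)
      then have "(\<lambda>m. enn2real (G m x)) \<longlonglongrightarrow> enn2real (SUP i. G i x)"
        using elim by (intro tendsto_enn2real) auto
      moreover have "incseq (\<lambda>m. enn2real (G m x))"
        using inc le elim by (auto simp: incseq_def intro!: enn2real_mono intro: le_less_trans)
      ultimately show ?case by simp
    qed
  qed (auto simp: L0_def)
  then have "N (\<lambda>x. enn2real (SUP i. G i x)) \<le> K"
    by (rule LIMSEQ_le_const2) (use bd in auto)
  then show ?thesis using fin by (simp add: ext_norm_def)
qed

text \<open>Finite subadditivity bounds every partial sum, and \<open>ext_norm_SUP_le\<close> passes
  to their supremum.\<close>

lemma ext_norm_suminf:
  assumes [measurable]: "\<And>i. G i \<in> borel_measurable lebesgue"
  shows "ext_norm N (\<lambda>x. \<Sum>i. G i x) \<le> (\<Sum>i. ext_norm N (G i))"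
proof (cases "(\<Sum>i. ext_norm N (G i)) < \<infinity>")
  case True
  have "ext_norm N (\<lambda>x. SUP n. \<Sum>i<n. G i x) \<le> (\<Sum>i. ext_norm N (G i))"
  proof (rule ext_norm_SUP_le)
    show "ext_norm N (\<lambda>x. \<Sum>i<n. G i x) \<le> (\<Sum>i. ext_norm N (G i))" for n
    proof -
      have "ext_norm N (\<lambda>x. \<Sum>i<n. G i x) \<le> (\<Sum>i<n. ext_norm N (G i))"
        by (rule ext_norm_sum) auto
      also have "\<dots> \<le> (\<Sum>i. ext_norm N (G i))"
        by (rule sum_le_suminf) auto
      finally show ?thesis .
    qed
    show "incseq (\<lambda>n x. \<Sum>i<n. G i x)"
      by (auto simp: incseq_def le_fun_def intro!: sum_mono2)
  qed (use True in auto)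
  then show ?thesis by (simp add: suminf_eq_SUP)
qed (simp add: less_top[symmetric])

end

section \<open>Radial integrals and ball averages\<close>

lemma nn_integral_lborel_scaleR:
  fixes g :: "'a::euclidean_space \<Rightarrow> ennreal"
  assumes [measurable]: "g \<in> borel_measurable borel" and "c \<noteq> 0"
  shows "(\<integral>\<^sup>+y. g y \<partial>lborel) = ennreal (\<bar>c\<bar> ^ DIM('a)) * (\<integral>\<^sup>+h. g (x + c *\<^sub>R h) \<partial>lborel)"
  by (subst lborel_affine[OF \<open>c \<noteq> 0\<close>, of x])
    (simp add: nn_integral_density nn_integral_distr nn_integral_cmult)

text \<open>Null sets pull back to null sets under \<open>h \<mapsto> x + c h\<close> with
  \<open>c \<noteq> 0\<close>. This is how a property of \<open>f\<close> known almost everywhere is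
  read off at \<open>x + j h\<close> for a fixed \<open>x\<close> and almost every
  \<open>h\<close>.\<close>

lemma AE_lborel_scaleR:
  fixes P :: "'a::euclidean_space \<Rightarrow> bool"
  assumes "AE y in lborel. P y" "c \<noteq> 0"
  shows "AE h in lborel. P (x + c *\<^sub>R h)"
proof -
  obtain B where B: "{y. \<not> P y} \<subseteq> B" "emeasure lborel B = 0" and [measurable]: "B \<in> sets borel"
    using AE_E[OF assms(1)] by auto
  have "(\<integral>\<^sup>+y. indicator B y \<partial>lborel) = 0"
    using B by simp
  also have "(\<integral>\<^sup>+y. indicator B y \<partial>lborel)
      = ennreal (\<bar>c\<bar> ^ DIM('a)) * (\<integral>\<^sup>+h. indicator B (x + c *\<^sub>R h) \<partial>lborel)"
    by (rule nn_integral_lborel_scaleR) (use assms in auto)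
  finally have "(\<integral>\<^sup>+h. indicator B (x + c *\<^sub>R h) \<partial>(lborel::'a measure)) = (0::ennreal)"
    using \<open>c \<noteq> 0\<close> by simp
  then have "AE h in lborel. indicator B (x + c *\<^sub>R h) = (0::ennreal)"
    by (subst (asm) nn_integral_0_iff_AE) auto
  then show ?thesis
    by eventually_elim (use B in \<open>auto simp: indicator_def split: if_splits\<close>)
qed

text \<open>Layer-cake proof: for \<open>norm h > 0\<close>,
  \<open>norm h powr -(n+a)\<close> is the integral of \<open>(n+a) * t powr -(n+a+1)\<close> over \<open>t \<ge> norm h\<close>.\<close>

lemma nn_integral_norm_powr_outside_ball:
  fixes R a :: real
  assumes R: "R > 0" and a: "a > 0"
  defines "n \<equiv> DIM('a::euclidean_space)"
  shows "(\<integral>\<^sup>+h. ennreal (1 / norm (h::'a) powr (n + a)) * indicator {h. R \<le> norm h} h \<partial>lborel)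
    = ennreal (n * unit_ball_vol n * R powr (- a) / a)"
proof -
  define p where "p = n + a"
  define \<omega> where "\<omega> = unit_ball_vol n"
  have p: "p > 0" using a by (simp add: p_def)
  have \<omega>: "\<omega> \<ge> 0" by (simp add: \<omega>_def)
  define K where "K t = ennreal (p * t powr (- p - 1))" for t :: real
  have [measurable]: "K \<in> borel_measurable borel" unfolding K_def by measurable
  have layer: "ennreal (1 / r powr p) = (\<integral>\<^sup>+t. K t * indicator {r..} t \<partial>lborel)" if "r > 0" for r :: real
  proof -
    have "(\<integral>\<^sup>+t. ennreal (p * t powr (- p - 1)) * indicator {r..} t \<partial>lborel)
        = ennreal (0 - (- (r powr (- p))))"
    proof (rule nn_integral_FTC_atLeast)
      show "((\<lambda>t. - (t powr - p)) has_real_derivative p * t powr (- p - 1)) (at t)" if "r \<le> t" for t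
        using that \<open>r > 0\<close> by (auto intro!: derivative_eq_intros)
      show "((\<lambda>t. - (t powr - p)) \<longlongrightarrow> 0) at_top"
        using tendsto_minus[OF tendsto_neg_powr[of "- p", OF _ filterlim_ident]] p by simp
    qed (use p in auto)
    then show ?thesis by (simp add: K_def powr_minus divide_simps)
  qed
  \<comment> \<open>For a fixed height \<open>t\<close> of the layer-cake formula, the admissible
    \<open>h\<close> fill the shell between the radii \<open>R\<close> and \<open>t\<close>; its
    volume is the inner integral after Tonelli.\<close>
  have shell: "(\<integral>\<^sup>+h. indicator {h. R \<le> norm h} h * indicator {norm h..} t \<partial>(lborel :: 'a measure))
      = ennreal (\<omega> * (t ^ n - R ^ n)) * indicator {R..} t" for t
  proof (cases "R \<le> t")
    case True
    have "(\<integral>\<^sup>+h. indicator {h. R \<le> norm h} h * indicator {norm h..} t \<partial>(lborel :: 'a measure))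
        = (\<integral>\<^sup>+h. indicator (cball 0 t - ball 0 R) h \<partial>(lborel :: 'a measure))"
      by (rule nn_integral_cong) (auto simp: indicator_def)
    also have "\<dots> = emeasure lborel (cball 0 t - ball 0 R :: 'a set)"
      by simp
    also have "\<dots> = emeasure lborel (cball 0 t :: 'a set) - emeasure lborel (ball 0 R :: 'a set)"
      using True R by (intro emeasure_Diff) (auto simp: emeasure_ball)
    also have "\<dots> = ennreal (\<omega> * t ^ n - \<omega> * R ^ n)"
      using True R by (simp add: emeasure_ball emeasure_cball ennreal_minus \<omega>_def n_def)
    finally show ?thesis using True by (simp add: right_diff_distrib)
  next
    case False
    then have zero: "indicator {h. R \<le> norm h} h * indicator {norm h..} t = (0::ennreal)" for h :: 'a
      by (auto simp: indicator_def)
    show ?thesis unfolding zero using False by simp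
  qed
  have "(\<integral>\<^sup>+h. ennreal (1 / norm (h::'a) powr p) * indicator {h. R \<le> norm h} h \<partial>lborel)
      = (\<integral>\<^sup>+h. (\<integral>\<^sup>+t. K t * (indicator {h. R \<le> norm h} h * indicator {norm h..} t) \<partial>lborel)
          \<partial>(lborel :: 'a measure))"
  proof (rule nn_integral_cong)
    fix h :: 'a
    show "ennreal (1 / norm h powr p) * indicator {h. R \<le> norm h} h
        = (\<integral>\<^sup>+t. K t * (indicator {h. R \<le> norm h} h * indicator {norm h..} t) \<partial>lborel)"
    proof (cases "R \<le> norm h")
      case True
      then have "0 < norm h" using R by linarith
      from layer[OF this] True show ?thesis by simp
    qed simp
  qed
  also have "\<dots> = (\<integral>\<^sup>+t. (\<integral>\<^sup>+h. K t * (indicator {h. R \<le> norm h} h * indicator {norm h..} t)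
          \<partial>(lborel :: 'a measure)) \<partial>lborel)"
  proof (rule lborel_pair.Fubini')
    have [measurable]: "Measurable.pred (borel \<Otimes>\<^sub>M borel) (\<lambda>(t::real, h::'a). norm h \<le> t)"
      by measurable
    show "(\<lambda>(t, h). K t * (indicator {h. R \<le> norm h} h * indicator {norm h..} t))
        \<in> borel_measurable (lborel \<Otimes>\<^sub>M (lborel :: 'a measure))"
      unfolding indicator_def atLeast_iff mem_Collect_eq by measurable
  qed
  also have "\<dots> = (\<integral>\<^sup>+t. K t * ennreal (\<omega> * (t ^ n - R ^ n)) * indicator {R..} t \<partial>lborel)"
  proof (rule nn_integral_cong)
    fix t :: real
    have "(\<lambda>h. indicator {h. R \<le> norm h} h * indicator {norm h..} t :: ennreal)
        \<in> borel_measurable (lborel :: 'a measure)"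
      unfolding indicator_def atLeast_iff mem_Collect_eq by measurable
    from nn_integral_cmult[OF this, of "K t"]
    show "(\<integral>\<^sup>+h. K t * (indicator {h. R \<le> norm h} h * indicator {norm h..} t) \<partial>(lborel :: 'a measure))
        = K t * ennreal (\<omega> * (t ^ n - R ^ n)) * indicator {R..} t"
      by (simp only: shell mult.assoc)
  qed
  also have "\<dots> = (\<integral>\<^sup>+t. ennreal (p * \<omega> * (t powr (- a - 1) - R ^ n * t powr (- p - 1)))
      * indicator {R..} t \<partial>lborel)"
  proof (rule nn_integral_cong)
    fix t :: real
    have "t powr (- p - 1) * t ^ n = t powr (- a - 1)" if "t > 0"
      using that by (simp add: p_def flip: powr_realpow powr_add)
    then have eq: "p * t powr (- p - 1) * (\<omega> * (t ^ n - R ^ n))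
        = p * \<omega> * (t powr (- a - 1) - R ^ n * t powr (- p - 1))" if "R \<le> t"
      using that R by (simp add: algebra_simps)
    show "K t * ennreal (\<omega> * (t ^ n - R ^ n)) * indicator {R..} t
        = ennreal (p * \<omega> * (t powr (- a - 1) - R ^ n * t powr (- p - 1))) * indicator {R..} t"
    proof (cases "R \<le> t")
      case True
      then have "0 \<le> \<omega> * (t ^ n - R ^ n)"
        using R \<omega> by (auto intro!: mult_nonneg_nonneg power_mono)
      then have "K t * ennreal (\<omega> * (t ^ n - R ^ n)) = ennreal (p * t powr (- p - 1) * (\<omega> * (t ^ n - R ^ n)))"
        unfolding K_def using p by (intro ennreal_mult[symmetric]) auto
      then show ?thesis using eq[OF True] by simp
    qed simp
  qed
  also have "\<dots> = ennreal (0 - p * \<omega> * (- (R powr - a / a) + R ^ n * (R powr - p / p)))"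
  proof (rule nn_integral_FTC_atLeast[where
        F = "\<lambda>t. p * \<omega> * (- (t powr - a / a) + R ^ n * (t powr - p / p))"])
    show "((\<lambda>t. p * \<omega> * (- (t powr - a / a) + R ^ n * (t powr - p / p)))
        has_real_derivative p * \<omega> * (t powr (- a - 1) - R ^ n * t powr (- p - 1))) (at t)"
      if "R \<le> t" for t
      using that R a p by (auto intro!: derivative_eq_intros simp: field_simps)
    show "((\<lambda>t. p * \<omega> * (- (t powr - a / a) + R ^ n * (t powr - p / p))) \<longlongrightarrow> 0) at_top"
    proof -
      have "((\<lambda>t. t powr - r) \<longlongrightarrow> 0) at_top" if "r > 0" for r :: real
        using that by (intro tendsto_neg_powr filterlim_ident) auto
      from tendsto_mult[OF tendsto_const tendsto_add[OF tendsto_minus[OF tendsto_divide[OF this[OF a] tendsto_const]]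
          tendsto_mult[OF tendsto_const tendsto_divide[OF this[OF p] tendsto_const]]]]
      show ?thesis using a p by simp
    qed
    \<comment> \<open>The fundamental theorem for nonnegative integrals needs the sign of the
      integrand, which is written as a difference; it follows from \<open>R \<le> t\<close>.\<close>
    show "0 \<le> p * \<omega> * (t powr (- a - 1) - R ^ n * t powr (- p - 1))" if "R \<le> t" for t
    proof -
      have "R ^ n * t powr (- p - 1) \<le> t ^ n * t powr (- p - 1)"
        using R that by (intro mult_right_mono power_mono) auto
      also have "\<dots> = t powr (- a - 1)"
        using R that by (simp add: p_def flip: powr_realpow powr_add)
      finally show ?thesis using p \<omega> by auto
    qed
  qed simp
  also have "0 - p * \<omega> * (- (R powr - a / a) + R ^ n * (R powr - p / p)) = n * \<omega> * R powr (- a) / a"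
  proof -
    have "R ^ n * R powr - p = R powr - a"
      using R by (simp add: p_def flip: powr_realpow powr_add)
    then have "R ^ n * (R powr - p / p) = R powr - a / p" by simp
    then show ?thesis using a p by (simp add: field_simps) (simp add: p_def algebra_simps)
  qed
  finally show ?thesis by (simp add: p_def \<omega>_def)
qed

text \<open>The cone over the unit sphere is the closed unit ball without its centre, and a single
  point is null.\<close>

lemma sphere_measure_unit:
  "sphere_measure (sphere (0::'a::euclidean_space) 1) = DIM('a) * unit_ball_vol DIM('a)"
proof -
  have "{t *\<^sub>R \<theta> | t \<theta>. 0 < t \<and> t \<le> 1 \<and> \<theta> \<in> sphere (0::'a) 1} = cball 0 1 - {0}" (is "?A = ?B")
  proof (rule set_eqI)
    fix x :: 'a
    show "x \<in> ?A \<longleftrightarrow> x \<in> ?B"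
    proof
      assume "x \<in> ?B"
      then have "x = norm x *\<^sub>R (x /\<^sub>R norm x)" "0 < norm x" "norm x \<le> 1" "x /\<^sub>R norm x \<in> sphere 0 1"
        by auto
      then show "x \<in> ?A" by blast
    qed auto
  qed
  moreover have "measure lebesgue (cball (0::'a) 1 - {0}) = measure lebesgue (cball (0::'a) 1)"
    by (rule measure_Diff_null_set) auto
  ultimately show ?thesis
    by (simp add: sphere_measure_def content_cball)
qed

section \<open>Dyadic shells and ball averages\<close>

lemma ex_dyadic_shell:
  fixes r :: real
  assumes "1 \<le> r"
  shows "\<exists>i::nat. 2 ^ i \<le> r \<and> r < 2 ^ Suc i"
proof -
  define i where "i = nat \<lfloor>log 2 r\<rfloor>"
  have "real i \<le> log 2 r" "log 2 r < real (Suc i)"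
    using assms by (auto simp: i_def) linarith
  then have "2 powr real i \<le> r" "r < 2 powr real (Suc i)"
    using assms by (simp_all add: le_log_iff log_less_iff)
  then show ?thesis by (auto simp: powr_realpow simp del: of_nat_Suc)
qed

text \<open>On the shell \<open>2 ^ i \<le> norm h < 2 ^ Suc i\<close> the weight is at most
  \<open>(1 / 2 powr p) ^ i\<close>. The shell is then enlarged to the ball of its outer radius, so
  that only integrals over full balls remain.\<close>

lemma nn_integral_norm_powr_le_dyadic:
  fixes g :: "'a::euclidean_space \<Rightarrow> ennreal" and p :: real
  assumes [measurable]: "g \<in> borel_measurable borel" and p: "p \<ge> 0"
  shows "(\<integral>\<^sup>+h. ennreal (1 / norm h powr p) * g h * indicator {h. 1 \<le> norm h} h \<partial>lborel)
    \<le> (\<Sum>i. ennreal ((1 / 2 powr p) ^ i) * (\<integral>\<^sup>+h\<in>ball 0 (2 ^ Suc i). g h \<partial>lborel))"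
proof -
  have "(\<integral>\<^sup>+h. ennreal (1 / norm h powr p) * g h * indicator {h. 1 \<le> norm h} h \<partial>lborel)
      \<le> (\<integral>\<^sup>+h. (\<Sum>i. ennreal ((1 / 2 powr p) ^ i) * (g h * indicator (ball 0 (2 ^ Suc i)) h)) \<partial>lborel)"
  proof (rule nn_integral_mono)
    fix h :: 'a
    show "ennreal (1 / norm h powr p) * g h * indicator {h. 1 \<le> norm h} h
        \<le> (\<Sum>i. ennreal ((1 / 2 powr p) ^ i) * (g h * indicator (ball 0 (2 ^ Suc i)) h))"
      (is "_ \<le> suminf ?s")
    proof (cases "1 \<le> norm h")
      case True
      then obtain i :: nat where i: "2 ^ i \<le> norm h" "norm h < 2 ^ Suc i"
        using ex_dyadic_shell by blast
      have "(2 powr p) ^ i = (2 ^ i) powr p"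
        by (simp add: powr_powr powr_realpow[symmetric] mult.commute)
      also have "\<dots> \<le> norm h powr p"
        using i p by (intro powr_mono2) auto
      finally have "1 / norm h powr p \<le> (1 / 2 powr p) ^ i"
        by (simp add: power_one_over frac_le)
      then have "ennreal (1 / norm h powr p) * g h \<le> ennreal ((1 / 2 powr p) ^ i) * g h"
        by (intro mult_right_mono ennreal_leI) auto
      also have "\<dots> = ?s i" using i by simp
      also have "\<dots> \<le> suminf ?s"
        using sum_le_suminf[of ?s "{i}"] by simp
      finally show ?thesis using True by simp
    qed simp
  qed
  also have "\<dots> = (\<Sum>i. ennreal ((1 / 2 powr p) ^ i) * (\<integral>\<^sup>+h\<in>ball 0 (2 ^ Suc i). g h \<partial>lborel))"
  proof -
    have [measurable]: "ball (0::'a) r \<in> sets borel" for r by simp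
    have "(\<integral>\<^sup>+h. ennreal ((1 / 2 powr p) ^ i) * (g h * indicator (ball 0 (2 ^ Suc i)) h) \<partial>lborel)
        = ennreal ((1 / 2 powr p) ^ i) * (\<integral>\<^sup>+h\<in>ball 0 (2 ^ Suc i). g h \<partial>lborel)" for i
      by (rule nn_integral_cmult) measurable
    then show ?thesis
      by (subst nn_integral_suminf) measurable
  qed
  finally show ?thesis .
qed

text \<open>The substitution \<open>y = x + c h\<close> carries the ball of radius \<open>r\<close>
  about 0 onto the ball of radius \<open>c * r\<close> about \<open>x\<close>; its Jacobian cancels
  against the volume of the image.\<close>

lemma nn_integral_translate_eq_ball_average:
  fixes F :: "'a::euclidean_space \<Rightarrow> real"
  assumes [measurable]: "F \<in> borel_measurable borel" and c: "c > 0" and r: "r > 0"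
  shows "(\<integral>\<^sup>+h\<in>ball 0 r. ennreal \<bar>F (x + c *\<^sub>R h)\<bar> \<partial>lborel)
    = ennreal (unit_ball_vol DIM('a) * r ^ DIM('a)) * ball_average (c * r) F x"
proof -
  define n where "n = DIM('a)"
  define \<omega> where "\<omega> = unit_ball_vol n"
  have \<omega>: "\<omega> > 0" by (simp add: \<omega>_def)
  define I where "I = (\<integral>\<^sup>+h\<in>ball 0 r. ennreal \<bar>F (x + c *\<^sub>R h)\<bar> \<partial>lborel)"
  have ball: "x + c *\<^sub>R h \<in> ball x (c * r) \<longleftrightarrow> h \<in> ball 0 r" for h
    using c by (simp add: dist_norm)
  have "(\<integral>\<^sup>+y\<in>ball x (c * r). ennreal \<bar>F y\<bar> \<partial>lborel) = ennreal (c ^ n) *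
      (\<integral>\<^sup>+h. ennreal \<bar>F (x + c *\<^sub>R h)\<bar> * indicator (ball x (c * r)) (x + c *\<^sub>R h) \<partial>lborel)"
    using c by (subst nn_integral_lborel_scaleR[of _ c x]) (measurable, simp_all add: n_def)
  also have "\<dots> = ennreal (c ^ n) * I"
    unfolding I_def indicator_def ball ..
  finally have "ball_average (c * r) F x = ennreal (c ^ n) * I / ennreal (\<omega> * (c * r) ^ n)"
    using c r by (simp add: ball_average_def nn_integral_completion emeasure_ball \<omega>_def n_def)
  also have "ennreal (\<omega> * r ^ n) * \<dots> = (ennreal (\<omega> * r ^ n) * ennreal (c ^ n)) / ennreal (\<omega> * (c * r) ^ n) * I"
    by (simp add: divide_ennreal_def mult_ac)
  also have "ennreal (\<omega> * r ^ n) * ennreal (c ^ n) = ennreal (\<omega> * (c * r) ^ n)"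
    using c r \<omega> by (simp add: power_mult_distrib mult_ac flip: ennreal_mult)
  also have "\<dots> / \<dots> = 1"
    using c r \<omega> by (subst divide_ennreal) auto
  finally show ?thesis by (simp add: I_def \<omega>_def n_def)
qed

lemma borel_measurable_ball_average [measurable]:
  fixes F :: "'a::euclidean_space \<Rightarrow> real"
  assumes [measurable]: "F \<in> borel_measurable borel"
  shows "ball_average r F \<in> borel_measurable borel"
proof (cases "r > 0")
  case True
  have [measurable]: "Measurable.pred (borel \<Otimes>\<^sub>M borel) (\<lambda>(x::'a, y::'a). dist x y < r)"
    by measurable
  have "(\<lambda>x. \<integral>\<^sup>+y\<in>ball x r. ennreal \<bar>F y\<bar> \<partial>lborel) \<in> borel_measurable borel"
    unfolding indicator_def mem_ball by measurable
  then show ?thesis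
    using True by (simp add: ball_average_def[abs_def] nn_integral_completion emeasure_ball)
qed (simp add: ball_average_def[abs_def] ball_empty)

section \<open>The upper bound\<close>

text \<open>The integral common to \<open>smoothness_fun\<close> and \<open>frak_D\<close> (there
  with \<open>\<sigma> = s * k\<close>), before the power \<open>1 / q\<close>. It is taken over
  \<open>lborel\<close>, so that Tonelli yields Borel measurability in \<open>x\<close> for Borel
  \<open>f\<close>.\<close>

definition diff_energy ::
  "real \<Rightarrow> nat \<Rightarrow> real \<Rightarrow> ('a::euclidean_space \<Rightarrow> real) \<Rightarrow> 'a \<Rightarrow> ennreal" where
  "diff_energy \<sigma> k q f x =
     (\<integral>\<^sup>+h. ennreal (\<bar>fdiff k h f x\<bar> powr q / norm h powr (real DIM('a) + \<sigma> * q)) \<partial>lborel)"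

lemma smoothness_fun_eq: "smoothness_fun \<sigma> k q f = (\<lambda>x. epowr (diff_energy \<sigma> k q f x) (1 / q))"
  by (simp add: smoothness_fun_def[abs_def] diff_energy_def nn_integral_completion)

lemma frak_D_eq: "frak_D s k q f = (\<lambda>x. epowr (diff_energy (s * real k) k q f x) (1 / q))"
  by (simp add: frak_D_def[abs_def] diff_energy_def nn_integral_completion)

text \<open>At a point \<open>x\<close> where the functions agree, they also agree at all
  \<open>x + j h\<close> with \<open>j \<le> k\<close>, for almost every \<open>h\<close>; the
  integrands then coincide.\<close>

lemma diff_energy_cong_AE:
  fixes f g :: "'a::euclidean_space \<Rightarrow> real"
  assumes eq: "AE x in lebesgue. f x = g x"
  shows "AE x in lebesgue. diff_energy \<sigma> k q f x = diff_energy \<sigma> k q g x"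
  using eq
proof eventually_elim
  case (elim x)
  have "AE h in lborel. \<forall>j\<in>{0..k}. f (x + real j *\<^sub>R h) = g (x + real j *\<^sub>R h)"
  proof (rule AE_finite_allI)
    fix j assume "j \<in> {0..k}"
    \<comment> \<open>The translate \<open>j = 0\<close> is \<open>x\<close> itself and cannot be
      reached by scaling in \<open>h\<close>; here the agreement at \<open>x\<close> is
      used.\<close>
    show "AE h in lborel. f (x + real j *\<^sub>R h) = g (x + real j *\<^sub>R h)"
      using elim AE_lborel_scaleR[of "\<lambda>y. f y = g y" "real j" x] eq
      by (cases "j = 0") (auto simp: AE_completion_iff)
  qed simp
  then have "AE h in lborel. fdiff k h f x = fdiff k h g x"
    by eventually_elim (auto simp: fdiff_def intro!: sum.cong)
  then show ?case
    unfolding diff_energy_def by (intro nn_integral_cong_AE) (auto elim: eventually_mono)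
qed

lemma borel_measurable_fdiff [measurable]:
  fixes f :: "'a::euclidean_space \<Rightarrow> real"
  assumes [measurable]: "f \<in> borel_measurable borel"
    and [measurable]: "u \<in> borel_measurable M" "v \<in> borel_measurable M"
  shows "(\<lambda>z. fdiff k (u z) f (v z)) \<in> borel_measurable M"
  unfolding fdiff_def by measurable

lemma borel_measurable_diff_energy [measurable]:
  fixes f :: "'a::euclidean_space \<Rightarrow> real"
  assumes [measurable]: "f \<in> borel_measurable borel"
  shows "diff_energy \<sigma> k q f \<in> borel_measurable borel"
proof -
  have "(\<lambda>(x, h). ennreal (\<bar>fdiff k h f x\<bar> powr q / norm h powr (real DIM('a) + \<sigma> * q)))
      \<in> borel_measurable (borel \<Otimes>\<^sub>M lborel)"
    by measurable
  then show ?thesis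
    unfolding diff_energy_def[abs_def] by measurable
qed

text \<open>A Borel representative of \<open>f\<close> has a Borel energy, and the two energies
  agree almost everywhere.\<close>

lemma lebesgue_measurable_diff_energy:
  fixes f :: "'a::euclidean_space \<Rightarrow> real"
  assumes "f \<in> L0"
  shows "diff_energy \<sigma> k q f \<in> borel_measurable lebesgue"
proof -
  obtain g :: "'a \<Rightarrow> real" where g: "g \<in> borel_measurable lborel" "AE x in lborel. f x = g x"
    using completion_ex_borel_measurable_real[of f lborel] assms by (auto simp: L0_def)
  have "diff_energy \<sigma> k q g \<in> borel_measurable lebesgue"
    using g by (intro measurable_completion) auto
  moreover have "AE x in lebesgue. diff_energy \<sigma> k q g x = diff_energy \<sigma> k q f x"
    using diff_energy_cong_AE[OF AE_completion[OF g(2)], where \<sigma> = \<sigma> and k = k and q = q]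
    by eventually_elim simp
  ultimately show ?thesis by (rule borel_measurable_lebesgue_AE_eq)
qed

text \<open>Each binomial coefficient is at most \<open>2 ^ k\<close>, so the difference is at most
  \<open>Suc k * 2 ^ k\<close> times the largest value \<open>\<bar>f (x + j h)\<bar>\<close>; the
  \<open>q\<close>-th power of that value is one of the summands on the right.\<close>

lemma fdiff_powr_le:
  fixes f :: "'a::euclidean_space \<Rightarrow> real"
  assumes "q \<ge> 0"
  shows "\<bar>fdiff k h f x\<bar> powr q
    \<le> (real (Suc k) * 2 ^ k) powr q * (\<Sum>j=0..k. \<bar>f (x + real j *\<^sub>R h)\<bar> powr q)"
proof -
  define a where "a j = \<bar>f (x + real j *\<^sub>R h)\<bar>" for j
  have "Max (a ` {0..k}) \<in> a ` {0..k}" by (rule Max_in) auto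
  then obtain j0 where j0: "j0 \<in> {0..k}" "Max (a ` {0..k}) = a j0" by blast
  have max: "a j \<le> a j0" if "j \<in> {0..k}" for j
    unfolding j0(2)[symmetric] using that by (intro Max_ge) auto
  have "\<bar>fdiff k h f x\<bar> \<le> (\<Sum>j=0..k. real (k choose j) * a j)"
    unfolding fdiff_def a_def
    by (rule order.trans[OF sum_abs]) (simp add: abs_mult power_abs)
  also have "\<dots> \<le> (\<Sum>j=0..k. 2 ^ k * a j0)"
  proof (rule sum_mono)
    fix j assume "j \<in> {0..k}"
    have "real (k choose j) \<le> real (2 ^ k)"
      using binomial_le_pow2[of k j] by (rule of_nat_mono)
    then show "real (k choose j) * a j \<le> 2 ^ k * a j0"
      using max[OF \<open>j \<in> {0..k}\<close>] by (intro mult_mono) (auto simp: a_def)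
  qed
  also have "\<dots> = real (Suc k) * 2 ^ k * a j0" by simp
  finally have "\<bar>fdiff k h f x\<bar> powr q \<le> (real (Suc k) * 2 ^ k * a j0) powr q"
    using assms by (intro powr_mono2) auto
  also have "\<dots> = (real (Suc k) * 2 ^ k) powr q * a j0 powr q"
    by (rule powr_mult)
  also have "a j0 powr q \<le> (\<Sum>j=0..k. a j powr q)"
    by (rule member_le_sum) (use j0 in auto)
  finally show ?thesis by (simp add: a_def mult_left_mono)
qed

section \<open>Splitting off the tails over \<open>1 \<le> norm h\<close>\<close>

text \<open>With \<open>p = s * k * q\<close>, \<open>F = \<bar>f\<bar> powr q\<close> and
  \<open>c = j\<close> this is the contribution of the \<open>j\<close>-th translate in
  \<open>fdiff_powr_le\<close> from large \<open>h\<close>.\<close>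

definition tail_integral :: "real \<Rightarrow> ('a::euclidean_space \<Rightarrow> real) \<Rightarrow> real \<Rightarrow> 'a \<Rightarrow> ennreal" where
  "tail_integral p F c x = (\<integral>\<^sup>+h. ennreal (1 / norm h powr (real DIM('a) + p)) * ennreal \<bar>F (x + c *\<^sub>R h)\<bar>
     * indicator {h. 1 \<le> norm h} h \<partial>lborel)"

lemma borel_measurable_tail_integral [measurable]:
  fixes F :: "'a::euclidean_space \<Rightarrow> real"
  assumes [measurable]: "F \<in> borel_measurable borel"
  shows "tail_integral p F c \<in> borel_measurable borel"
proof -
  have [measurable]: "{h::'a. 1 \<le> norm h} \<in> sets borel" by measurable
  have "(\<lambda>(x, h). ennreal (1 / norm h powr (real DIM('a) + p)) * ennreal \<bar>F (x + c *\<^sub>R h)\<bar>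
     * indicator {h. 1 \<le> norm h} h) \<in> borel_measurable (borel \<Otimes>\<^sub>M lborel)"
    by measurable
  then show ?thesis
    unfolding tail_integral_def[abs_def] by measurable
qed

text \<open>Inside the unit ball a larger smoothness gives a larger weight; outside it the
  difference is estimated translate by translate.\<close>

lemma diff_energy_le:
  fixes f :: "'a::euclidean_space \<Rightarrow> real"
  assumes [measurable]: "f \<in> borel_measurable borel" and q: "q \<ge> 0" and \<tau>: "\<tau> \<le> \<sigma>"
  shows "diff_energy \<tau> k q f x \<le> diff_energy \<sigma> k q f x + ennreal ((real (Suc k) * 2 ^ k) powr q) *
    (\<Sum>j=0..k. tail_integral (\<tau> * q) (\<lambda>x. \<bar>f x\<bar> powr q) (real j) x)"
proof -
  define n where "n = real DIM('a)"
  define c where "c = (real (Suc k) * 2 ^ k) powr q"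
  have [measurable]: "{h::'a. 1 \<le> norm h} \<in> sets borel" by measurable
  define T where "T j h = ennreal (1 / norm h powr (n + \<tau> * q)) * ennreal \<bar>\<bar>f (x + real j *\<^sub>R h)\<bar> powr q\<bar>
     * indicator {h. 1 \<le> norm h} h" for j h
  have [measurable]: "T j \<in> borel_measurable borel" for j
    unfolding T_def by measurable
  have "diff_energy \<tau> k q f x
      \<le> (\<integral>\<^sup>+h. ennreal (\<bar>fdiff k h f x\<bar> powr q / norm h powr (n + \<sigma> * q)) + ennreal c * (\<Sum>j=0..k. T j h) \<partial>lborel)"
    unfolding diff_energy_def n_def[symmetric]
  proof (rule nn_integral_mono)
    fix h :: 'a
    show "ennreal (\<bar>fdiff k h f x\<bar> powr q / norm h powr (n + \<tau> * q))
        \<le> ennreal (\<bar>fdiff k h f x\<bar> powr q / norm h powr (n + \<sigma> * q)) + ennreal c * (\<Sum>j=0..k. T j h)"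
    proof (cases "norm h < 1")
      case True
      have "norm h powr (n + \<sigma> * q) \<le> norm h powr (n + \<tau> * q)"
        using True \<tau> q by (intro powr_mono') (auto intro: mult_right_mono)
      then have "\<bar>fdiff k h f x\<bar> powr q / norm h powr (n + \<tau> * q)
          \<le> \<bar>fdiff k h f x\<bar> powr q / norm h powr (n + \<sigma> * q)"
        \<comment> \<open>At \<open>h = 0\<close> both quotients are 0, because
          \<open>0 powr a = 0\<close> and division by 0 gives 0.\<close>
        by (cases "h = 0") (auto intro!: divide_left_mono)
      then show ?thesis
        by (intro add_increasing2 ennreal_leI) auto
    next
      case False
      have "ennreal (\<bar>fdiff k h f x\<bar> powr q / norm h powr (n + \<tau> * q))
          \<le> ennreal (c * (\<Sum>j=0..k. \<bar>f (x + real j *\<^sub>R h)\<bar> powr q) / norm h powr (n + \<tau> * q))"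
        unfolding c_def by (intro ennreal_leI divide_right_mono fdiff_powr_le q) auto
      also have "\<dots> = ennreal (c * (\<Sum>j=0..k. 1 / norm h powr (n + \<tau> * q) * \<bar>f (x + real j *\<^sub>R h)\<bar> powr q))"
        by (simp add: sum_divide_distrib[symmetric])
      also have "\<dots> = ennreal c * ennreal (\<Sum>j=0..k. 1 / norm h powr (n + \<tau> * q) * \<bar>f (x + real j *\<^sub>R h)\<bar> powr q)"
        by (rule ennreal_mult) (auto simp: c_def intro!: sum_nonneg)
      also have "ennreal (\<Sum>j=0..k. 1 / norm h powr (n + \<tau> * q) * \<bar>f (x + real j *\<^sub>R h)\<bar> powr q)
          = (\<Sum>j=0..k. ennreal (1 / norm h powr (n + \<tau> * q) * \<bar>f (x + real j *\<^sub>R h)\<bar> powr q))"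
        by (rule sum_ennreal[symmetric]) auto
      also have "\<dots> = (\<Sum>j=0..k. T j h)"
        using False by (intro sum.cong refl) (simp add: T_def ennreal_mult[symmetric])
      finally show ?thesis
        by (intro add_increasing) auto
    qed
  qed
  also have "\<dots> = diff_energy \<sigma> k q f x + ennreal c * (\<Sum>j=0..k. \<integral>\<^sup>+h. T j h \<partial>lborel)"
    by (simp add: nn_integral_add nn_integral_cmult nn_integral_sum diff_energy_def n_def)
  finally show ?thesis
    by (simp add: tail_integral_def T_def n_def c_def)
qed

text \<open>For \<open>c = 0\<close> the value \<open>F x\<close> leaves the integral, and the
  radial integral outside radius 1 remains.\<close>

lemma tail_integral_0:
  fixes F :: "'a::euclidean_space \<Rightarrow> real"
  assumes "p > 0"
  shows "tail_integral p F 0 x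
    = ennreal (DIM('a) * unit_ball_vol DIM('a) / p) * ennreal \<bar>F x\<bar>"
proof -
  have [measurable]: "{h::'a. 1 \<le> norm h} \<in> sets borel" by measurable
  have "tail_integral p F 0 x = (\<integral>\<^sup>+h. ennreal \<bar>F x\<bar> *
      (ennreal (1 / norm (h::'a) powr (real DIM('a) + p)) * indicator {h. 1 \<le> norm h} h) \<partial>lborel)"
    by (simp add: tail_integral_def mult_ac)
  also have "\<dots> = ennreal \<bar>F x\<bar> *
      (\<integral>\<^sup>+h. ennreal (1 / norm (h::'a) powr (real DIM('a) + p)) * indicator {h. 1 \<le> norm h} h \<partial>lborel)"
    by (rule nn_integral_cmult) measurable
  finally show ?thesis
    using nn_integral_norm_powr_outside_ball[of 1 p, where 'a='a] assms by (simp add: mult.commute)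
qed

text \<open>The volume of the ball of radius \<open>2 ^ Suc i\<close> grows like
  \<open>2 ^ (i * n)\<close>. It cancels the dimensional part of the weight and leaves the ratio
  \<open>1 / 2 powr p\<close>.\<close>

lemma tail_integral_le_dyadic:
  fixes F :: "'a::euclidean_space \<Rightarrow> real"
  assumes [measurable]: "F \<in> borel_measurable borel" and c: "c > 0" and p: "p \<ge> 0"
  shows "tail_integral p F c x
    \<le> (\<Sum>i. ennreal (unit_ball_vol DIM('a) * 2 ^ DIM('a) * (1 / 2 powr p) ^ i) * ball_average (c * 2 ^ Suc i) F x)"
proof -
  define n where "n = DIM('a)"
  have "tail_integral p F c x \<le> (\<Sum>i. ennreal ((1 / 2 powr (real n + p)) ^ i) *
      (\<integral>\<^sup>+h\<in>ball 0 (2 ^ Suc i). ennreal \<bar>F (x + c *\<^sub>R h)\<bar> \<partial>lborel))"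
    unfolding tail_integral_def n_def
    by (rule nn_integral_norm_powr_le_dyadic) (use p in auto)
  also have "\<dots> = (\<Sum>i. ennreal (unit_ball_vol n * 2 ^ n * (1 / 2 powr p) ^ i) * ball_average (c * 2 ^ Suc i) F x)"
  proof (rule suminf_cong)
    fix i :: nat
    have "(2::real) powr (real n + p) = 2 ^ n * 2 powr p"
      by (simp add: powr_add powr_realpow)
    moreover have "((2::real) ^ Suc i) ^ n = 2 ^ n * (2 ^ n) ^ i"
      by (simp add: power_mult_distrib mult.commute flip: power_mult)
    ultimately have eq: "(1 / 2 powr (real n + p)) ^ i * (unit_ball_vol n * (2 ^ Suc i) ^ n)
        = unit_ball_vol n * 2 ^ n * (1 / 2 powr p) ^ i"
      by (simp add: power_divide power_mult_distrib)
    have "ennreal ((1 / 2 powr (real n + p)) ^ i) *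
        (\<integral>\<^sup>+h\<in>ball 0 (2 ^ Suc i). ennreal \<bar>F (x + c *\<^sub>R h)\<bar> \<partial>lborel)
      = ennreal ((1 / 2 powr (real n + p)) ^ i) * (ennreal (unit_ball_vol n * (2 ^ Suc i) ^ n)
        * ball_average (c * 2 ^ Suc i) F x)"
      using c by (subst nn_integral_translate_eq_ball_average) (auto simp: n_def)
    also have "\<dots> = ennreal ((1 / 2 powr (real n + p)) ^ i * (unit_ball_vol n * (2 ^ Suc i) ^ n))
        * ball_average (c * 2 ^ Suc i) F x"
      by (subst ennreal_mult) (auto simp: mult.assoc)
    finally show "ennreal ((1 / 2 powr (real n + p)) ^ i) *
        (\<integral>\<^sup>+h\<in>ball 0 (2 ^ Suc i). ennreal \<bar>F (x + c *\<^sub>R h)\<bar> \<partial>lborel)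
      = ennreal (unit_ball_vol n * 2 ^ n * (1 / 2 powr p) ^ i) * ball_average (c * 2 ^ Suc i) F x"
      unfolding eq .
  qed
  finally show ?thesis unfolding n_def .
qed

text \<open>Young's inequality gives \<open>1 / 2 powr p \<le> 1 - p / 2\<close>. The resulting
  order \<open>1 / p\<close> is what the factor \<open>s\<close> in the theorem compensates.\<close>

lemma geometric_series_half_powr_le:
  fixes p :: real
  assumes "0 < p" "p \<le> 1"
  shows "(\<Sum>i. ennreal ((1 / 2 powr p) ^ i)) \<le> ennreal (2 / p)"
proof -
  define \<rho> where "\<rho> = 1 / 2 powr p"
  have "(1 / 2) powr p * 1 powr (1 - p) \<le> p * (1 / 2) + (1 - p) * 1"
    by (rule Youngs_inequality_0) (use assms in auto)
  then have \<rho>: "\<rho> \<le> 1 - p / 2" "0 \<le> \<rho>"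
    by (simp_all add: \<rho>_def powr_divide)
  then have "(\<lambda>i. \<rho> ^ i) sums (1 / (1 - \<rho>))"
    using assms by (intro geometric_sums) auto
  then have "(\<lambda>i. ennreal (\<rho> ^ i)) sums ennreal (1 / (1 - \<rho>))"
    using \<rho> assms by (subst sums_ennreal) auto
  then have "(\<Sum>i. ennreal (\<rho> ^ i)) = ennreal (1 / (1 - \<rho>))"
    by (rule sums_unique[symmetric])
  also have "\<dots> \<le> ennreal (2 / p)"
    using \<rho> assms by (intro ennreal_leI) (simp add: divide_simps)
  finally show ?thesis unfolding \<rho>_def .
qed

section \<open>Norm estimates for the tails and the energy\<close>

context ball_banach_function_space
begin

text \<open>Countable subadditivity over the dyadic scales: the averages are bounded with the same
  \<open>C\<close> at every radius, so only the geometric series is left.\<close>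

lemma ext_norm_tail_integral_le:
  fixes F :: "'a \<Rightarrow> real"
  assumes [measurable]: "F \<in> borel_measurable borel" and F: "N F < \<infinity>"
    and c: "c > 0" and p: "0 < p" "p \<le> 1" and C: "C \<ge> 0"
    and avg: "\<And>r f. r > 0 \<Longrightarrow> f \<in> fspace N \<Longrightarrow> ext_norm N (ball_average r f) \<le> ennreal C * N f"
  shows "ext_norm N (tail_integral p F c)
    \<le> ennreal (2 * unit_ball_vol DIM('a) * 2 ^ DIM('a) * C / p) * N F"
proof -
  define A where "A = unit_ball_vol DIM('a) * 2 ^ DIM('a)"
  have A: "A > 0" by (simp add: A_def)
  have "ext_norm N (tail_integral p F c)
      \<le> ext_norm N (\<lambda>x. \<Sum>i. ennreal (A * (1 / 2 powr p) ^ i) * ball_average (c * 2 ^ Suc i) F x)"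
    unfolding A_def
    by (intro ext_norm_mono measurable_completion AE_I2 tail_integral_le_dyadic) (use c p in auto)
  also have "\<dots> \<le> (\<Sum>i. ext_norm N (\<lambda>x. ennreal (A * (1 / 2 powr p) ^ i) * ball_average (c * 2 ^ Suc i) F x))"
    by (intro ext_norm_suminf measurable_completion) auto
  also have "\<dots> \<le> (\<Sum>i. ennreal ((1 / 2 powr p) ^ i) * (ennreal A * (ennreal C * N F)))"
  proof (rule suminf_le)
    fix i
    have "ext_norm N (\<lambda>x. ennreal (A * (1 / 2 powr p) ^ i) * ball_average (c * 2 ^ Suc i) F x)
        = ennreal (A * (1 / 2 powr p) ^ i) * ext_norm N (ball_average (c * 2 ^ Suc i) F)"
      using A by (intro ext_norm_cmult measurable_completion) auto
    also have "\<dots> \<le> ennreal (A * (1 / 2 powr p) ^ i) * (ennreal C * N F)"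
      using c F by (intro mult_left_mono avg)
        (auto simp: fspace_def L0_def intro!: measurable_completion)
    also have "\<dots> = ennreal ((1 / 2 powr p) ^ i) * (ennreal A * (ennreal C * N F))"
      using A by (simp add: ennreal_mult mult_ac)
    finally show "ext_norm N (\<lambda>x. ennreal (A * (1 / 2 powr p) ^ i) * ball_average (c * 2 ^ Suc i) F x) \<le> \<dots>" .
  qed auto
  also have "\<dots> = (\<Sum>i. ennreal ((1 / 2 powr p) ^ i)) * (ennreal A * (ennreal C * N F))"
    by (rule ennreal_suminf_multc)
  also have "\<dots> \<le> ennreal (2 / p) * (ennreal A * (ennreal C * N F))"
    using p by (intro mult_right_mono geometric_series_half_powr_le) auto
  also have "\<dots> = ennreal (2 * A * C / p) * N F"
    using A C p by (simp add: mult.assoc[symmetric] flip: ennreal_mult)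
  finally show ?thesis by (simp add: A_def mult_ac)
qed

text \<open>Meant for \<open>N\<close> the norm of \<open>X^(1/q)\<close>. The summand
  \<open>DIM('a)\<close> in the constant comes from the translate \<open>j = 0\<close>, the summand
  with \<open>C\<close> from the \<open>k\<close> others; the blow-up in \<open>\<tau>\<close> is
  exactly \<open>1 / \<tau>\<close>.\<close>

lemma ext_norm_diff_energy_le_borel:
  fixes f :: "'a \<Rightarrow> real"
  assumes [measurable]: "f \<in> borel_measurable borel" and F: "N (\<lambda>x. \<bar>f x\<bar> powr q) < \<infinity>"
    and q: "q \<ge> 1" and \<tau>: "0 < \<tau>" "\<tau> * q \<le> 1" "\<tau> \<le> \<sigma>" and C: "C \<ge> 0"
    and avg: "\<And>r f. r > 0 \<Longrightarrow> f \<in> fspace N \<Longrightarrow> ext_norm N (ball_average r f) \<le> ennreal C * N f"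
  shows "ext_norm N (diff_energy \<tau> k q f) \<le> ext_norm N (diff_energy \<sigma> k q f) +
    ennreal ((real (Suc k) * 2 ^ k) powr q * unit_ball_vol DIM('a)
      * (DIM('a) + real k * 2 * 2 ^ DIM('a) * C) / (\<tau> * q)) * N (\<lambda>x. \<bar>f x\<bar> powr q)"
proof -
  define B where "B = (real (Suc k) * 2 ^ k) powr q"
  have B: "B > 0" unfolding B_def by (subst powr_gt_zero) auto
  define p where "p = \<tau> * q"
  have p: "0 < p" "p \<le> 1" using \<tau> q by (auto simp: p_def)
  define \<omega> where "\<omega> = unit_ball_vol DIM('a)"
  have \<omega>: "\<omega> > 0" by (simp add: \<omega>_def)
  define F where "F = (\<lambda>x. \<bar>f x\<bar> powr q)"
  have [measurable]: "F \<in> borel_measurable borel" by (simp add: F_def)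
  define D where "D = 2 * \<omega> * 2 ^ DIM('a) * C / p"
  have D: "D \<ge> 0" using C p \<omega> by (simp add: D_def)
  have tail: "ext_norm N (tail_integral p F (real j))
      \<le> (if j = 0 then ennreal (DIM('a) * \<omega> / p) * N F else ennreal D * N F)" for j
  proof (cases "j = 0")
    case True
    have "ext_norm N (tail_integral p F 0) = ext_norm N (\<lambda>x. ennreal (DIM('a) * \<omega> / p) * ennreal \<bar>F x\<bar>)"
      using tail_integral_0[OF p(1), of F]
      by (intro arg_cong[where f = "ext_norm N"] ext) (simp add: \<omega>_def)
    also have "\<dots> = ennreal (DIM('a) * \<omega> / p) * ext_norm N (\<lambda>x. ennreal \<bar>F x\<bar>)"
      using p \<omega> by (intro ext_norm_cmult measurable_completion) auto
    also have "ext_norm N (\<lambda>x. ennreal \<bar>F x\<bar>) = N F"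
      by (intro ext_norm_ennreal) (auto simp: L0_def intro!: measurable_completion)
    finally show ?thesis using True by simp
  next
    case False
    then show ?thesis
      using ext_norm_tail_integral_le[of F "real j" p C] F p C avg by (simp add: D_def \<omega>_def F_def)
  qed
  have "ext_norm N (\<lambda>x. ennreal B * (\<Sum>j=0..k. tail_integral p F (real j) x))
      = ennreal B * ext_norm N (\<lambda>x. \<Sum>j=0..k. tail_integral p F (real j) x)"
    using B by (intro ext_norm_cmult measurable_completion) auto
  also have "\<dots> \<le> ennreal B * (\<Sum>j=0..k. ext_norm N (tail_integral p F (real j)))"
    by (intro mult_left_mono ext_norm_sum measurable_completion) auto
  also have "\<dots> \<le> ennreal B * (\<Sum>j=0..k. if j = 0 then ennreal (DIM('a) * \<omega> / p) * N F else ennreal D * N F)"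
    by (intro mult_left_mono sum_mono tail) auto
  also have "\<dots> = ennreal B * (ennreal (DIM('a) * \<omega> / p) * N F + of_nat k * (ennreal D * N F))"
    by (simp add: sum.atLeast_Suc_atMost)
  also have "\<dots> = ennreal (B * (DIM('a) * \<omega> / p + k * D)) * N F"
    using B p \<omega> D by (simp add: ennreal_plus ennreal_mult distrib_right mult.assoc flip: ennreal_of_nat_eq_real_of_nat)
  also have "B * (DIM('a) * \<omega> / p + k * D) = B * \<omega> * (DIM('a) + real k * 2 * 2 ^ DIM('a) * C) / p"
    using p by (simp add: D_def field_simps)
  finally have tails: "ext_norm N (\<lambda>x. ennreal B * (\<Sum>j=0..k. tail_integral p F (real j) x))
      \<le> ennreal (B * \<omega> * (DIM('a) + real k * 2 * 2 ^ DIM('a) * C) / p) * N F" .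
  have "ext_norm N (diff_energy \<tau> k q f)
      \<le> ext_norm N (\<lambda>x. diff_energy \<sigma> k q f x + ennreal B * (\<Sum>j=0..k. tail_integral p F (real j) x))"
    unfolding B_def p_def F_def
    by (intro ext_norm_mono measurable_completion AE_I2 diff_energy_le) (use \<tau> q in auto)
  also have "\<dots> \<le> ext_norm N (diff_energy \<sigma> k q f)
      + ext_norm N (\<lambda>x. ennreal B * (\<Sum>j=0..k. tail_integral p F (real j) x))"
    by (intro ext_norm_add measurable_completion) auto
  also have "\<dots> \<le> ext_norm N (diff_energy \<sigma> k q f)
      + ennreal (B * \<omega> * (DIM('a) + real k * 2 * 2 ^ DIM('a) * C) / p) * N F"
    by (intro add_left_mono tails)
  finally show ?thesis
    unfolding B_def \<omega>_def p_def F_def .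
qed

end

text \<open>Both sides depend only on the almost everywhere class of \<open>f\<close>, so a Borel
  representative may replace it.\<close>

lemma ext_norm_diff_energy_le:
  fixes f :: "'a::euclidean_space \<Rightarrow> real"
  assumes "ball_banach_function_space N"
    and f: "f \<in> L0" and F: "N (\<lambda>x. \<bar>f x\<bar> powr q) < \<infinity>"
    and q: "q \<ge> 1" and \<tau>: "0 < \<tau>" "\<tau> * q \<le> 1" "\<tau> \<le> \<sigma>" and C: "C \<ge> 0"
    and avg: "\<And>r f. r > 0 \<Longrightarrow> f \<in> fspace N \<Longrightarrow> ext_norm N (ball_average r f) \<le> ennreal C * N f"
  shows "ext_norm N (diff_energy \<tau> k q f) \<le> ext_norm N (diff_energy \<sigma> k q f) +
    ennreal ((real (Suc k) * 2 ^ k) powr q * unit_ball_vol DIM('a)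
      * (DIM('a) + real k * 2 * 2 ^ DIM('a) * C) / (\<tau> * q)) * N (\<lambda>x. \<bar>f x\<bar> powr q)"
proof -
  interpret ball_banach_function_space N by fact
  obtain g :: "'a \<Rightarrow> real" where g: "g \<in> borel_measurable lborel" and "AE x in lborel. f x = g x"
    using completion_ex_borel_measurable_real[of f lborel] f by (auto simp: L0_def)
  then have eq: "AE x in lebesgue. f x = g x" by (intro AE_completion)
  have g_L0: "g \<in> L0" using g by (auto simp: L0_def intro: measurable_completion)
  have energy: "ext_norm N (diff_energy \<rho> k q f) = ext_norm N (diff_energy \<rho> k q g)" for \<rho>
    by (intro ext_norm_cong lebesgue_measurable_diff_energy diff_energy_cong_AE f g_L0 eq)
  have "N (\<lambda>x. \<bar>f x\<bar> powr q) = N (\<lambda>x. \<bar>g x\<bar> powr q)"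
    by (rule norm_cong) (use f g_L0 eq in \<open>auto simp: L0_def elim: eventually_mono\<close>)
  then show ?thesis
    unfolding energy using ext_norm_diff_energy_le_borel[of g q \<tau> \<sigma> C k] g F q \<tau> C avg by simp
qed

lemma frak_D_measurable: "f \<in> L0 \<Longrightarrow> frak_D s k q f \<in> borel_measurable lebesgue"
  unfolding frak_D_eq by (intro borel_measurable_epowr lebesgue_measurable_diff_energy)

section \<open>Transfer between \<open>X^(1/q)\<close> and \<open>X\<close>\<close>

context ball_banach_function_space
begin

lemma convexification_powr:
  assumes "f \<in> L0" "q > 0"
  shows "convexification (1 / q) N (\<lambda>x. \<bar>f x\<bar> powr q) = epowr (N f) q"
proof -
  have "N (\<lambda>x. \<bar>\<bar>f x\<bar> powr q\<bar> powr (1 / q)) = N f"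
    by (rule norm_cong) (use assms in \<open>auto simp: L0_def powr_powr\<close>)
  then show ?thesis by (simp add: convexification_def)
qed

text \<open>The norm of \<open>X^(1/q)\<close> is the \<open>q\<close>-th power of the norm of the
  \<open>1 / q\<close>-th power; the outer exponent \<open>1 / q\<close> undoes the former.\<close>

lemma ext_norm_epowr:
  assumes [measurable]: "G \<in> borel_measurable lebesgue" and "q > 0"
  shows "ext_norm N (\<lambda>x. epowr (G x) (1 / q)) = epowr (ext_norm (convexification (1 / q) N) G) (1 / q)"
proof (cases "AE x in lebesgue. G x < \<infinity>")
  case True
  have "N (\<lambda>x. enn2real (epowr (G x) (1 / q))) = N (\<lambda>x. \<bar>enn2real (G x)\<bar> powr (1 / q))"
    by (rule norm_cong) (use True in \<open>auto simp: L0_def enn2real_epowr elim: eventually_mono\<close>)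
  then show ?thesis
    using True \<open>q > 0\<close> by (simp add: ext_norm_def convexification_def)
qed (simp add: ext_norm_def)

text \<open>The order of the quantifiers matters: \<open>C\<close> is chosen before \<open>f\<close>
  and \<open>\<sigma>\<close>, whereas \<open>A\<close> and \<open>s0\<close> may depend on them.
  The energy at the fixed smoothness \<open>\<sigma>\<close> enters only through
  \<open>A * s\<close>, which vanishes in the limit.\<close>

lemma ext_norm_frak_D_le:
  assumes conv: "ball_banach_function_space (convexification (1 / q) N)"
    and avg: "ball_averages_uniformly_bounded (convexification (1 / q) N)"
    and q: "q \<ge> 1" and k: "k \<ge> 1"
  shows "\<exists>C>0. \<forall>\<sigma>>0. \<forall>f\<in>F_space N \<sigma> k q. \<exists>A\<ge>0. \<exists>s0>0. \<forall>s. 0 < s \<longrightarrow> s < s0 \<longrightarrow>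
    ennreal (s powr (1 / q)) * ext_norm N (frak_D s k q f)
      \<le> ennreal ((A * s + C * enn2real (N f) powr q) powr (1 / q))"
proof -
  define Z where "Z = convexification (1 / q) N"
  interpret Z: ball_banach_function_space Z unfolding Z_def by fact
  obtain C0 where C0: "C0 > 0"
    "\<And>r f. r > 0 \<Longrightarrow> f \<in> fspace Z \<Longrightarrow> ext_norm Z (ball_average r f) \<le> ennreal C0 * Z f"
    using avg unfolding ball_averages_uniformly_bounded_def Z_def by blast
  define K where "K = (real (Suc k) * 2 ^ k) powr q * unit_ball_vol DIM('a)
      * (DIM('a) + real k * 2 * 2 ^ DIM('a) * C0)"
  have K: "K > 0"
    unfolding K_def using C0(1) by (intro mult_pos_pos add_pos_nonneg) (auto simp del: of_nat_Suc)
  have kq: "real k * q > 0" using k q by simp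
  \<comment> \<open>The tail bound at smoothness \<open>s * k\<close> is
    \<open>K / (s * k * q)\<close>; multiplication by \<open>s\<close> leaves this value.\<close>
  define C where "C = K / (k * q)"
  have "C > 0" using K kq by (simp add: C_def)
  moreover have "\<exists>A\<ge>0. \<exists>s0>0. \<forall>s. 0 < s \<longrightarrow> s < s0 \<longrightarrow>
      ennreal (s powr (1 / q)) * ext_norm N (frak_D s k q f)
        \<le> ennreal ((A * s + C * enn2real (N f) powr q) powr (1 / q))"
    if \<sigma>: "\<sigma> > 0" and f: "f \<in> F_space N \<sigma> k q" for \<sigma> f
  proof -
    have L0: "f \<in> L0" and Nf: "N f < \<infinity>" and Sf: "ext_norm N (smoothness_fun \<sigma> k q f) < \<infinity>"
      using f by (auto simp: F_space_def fspace_def F_norm_def)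
    have ext: "ext_norm N (\<lambda>x. epowr (diff_energy \<tau> k q f x) (1 / q))
        = epowr (ext_norm Z (diff_energy \<tau> k q f)) (1 / q)" for \<tau>
      unfolding Z_def using q by (intro ext_norm_epowr lebesgue_measurable_diff_energy L0) auto
    define A where "A = enn2real (ext_norm Z (diff_energy \<sigma> k q f))"
    have A: "ext_norm Z (diff_energy \<sigma> k q f) = ennreal A"
      using Sf by (simp add: A_def smoothness_fun_eq ext less_top)
    define y where "y = enn2real (N f) powr q"
    have Zf: "Z (\<lambda>x. \<bar>f x\<bar> powr q) = ennreal y"
      using convexification_powr[OF L0, of q] q Nf
      by (cases "N f") (auto simp: Z_def y_def epowr_ennreal)
    \<comment> \<open>Below \<open>\<sigma> / k\<close> the smoothness \<open>s * k\<close> does not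
      exceed \<open>\<sigma>\<close>; below \<open>1 / (k * q)\<close> the estimate of the geometric
      series applies.\<close>
    have "ennreal (s powr (1 / q)) * ext_norm N (frak_D s k q f) \<le> ennreal ((A * s + C * y) powr (1 / q))"
      if s: "0 < s" "s < min (\<sigma> / k) (1 / (k * q))" for s
    proof -
      have \<tau>: "0 < s * k" "s * k * q \<le> 1" "s * k \<le> \<sigma>"
        using s k q kq by (auto simp: field_simps)
      have "ext_norm Z (diff_energy (s * k) k q f)
          \<le> ext_norm Z (diff_energy \<sigma> k q f) + ennreal (K / (s * k * q)) * Z (\<lambda>x. \<bar>f x\<bar> powr q)"
        unfolding K_def using C0 q \<tau> Zf by (intro ext_norm_diff_energy_le Z.ball_banach_function_space_axioms L0) auto
      also have "\<dots> = ennreal A + ennreal (K / (s * k * q)) * ennreal y"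
        unfolding A Zf ..
      also have "\<dots> = ennreal (A + K / (s * k * q) * y)"
      proof -
        have nonneg: "0 \<le> A" "0 \<le> K / (s * k * q)" "0 \<le> y"
          using K s k q by (auto simp: A_def y_def)
        show ?thesis
          by (simp only: ennreal_plus[OF nonneg(1) mult_nonneg_nonneg[OF nonneg(2,3)]] ennreal_mult[OF nonneg(2,3)])
      qed
      finally have "ennreal s * ext_norm Z (diff_energy (s * k) k q f)
          \<le> ennreal s * ennreal (A + K / (s * k * q) * y)"
        by (rule mult_left_mono) simp
      also have "\<dots> = ennreal (s * (A + K / (s * k * q) * y))"
        using K s kq q by (intro ennreal_mult[symmetric]) (auto simp: A_def y_def)
      also have "s * (A + K / (s * k * q) * y) = A * s + C * y"
        using s by (simp add: C_def field_simps)
      finally have le: "ennreal s * ext_norm Z (diff_energy (s * k) k q f) \<le> ennreal (A * s + C * y)" .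
      have "ennreal (s powr (1 / q)) * ext_norm N (frak_D s k q f)
          = epowr (ennreal s * ext_norm Z (diff_energy (s * k) k q f)) (1 / q)"
        using s by (simp add: frak_D_eq ext epowr_mult)
      also have "\<dots> \<le> epowr (ennreal (A * s + C * y)) (1 / q)"
        using le q by (intro epowr_mono) auto
      also have "\<dots> = ennreal ((A * s + C * y) powr (1 / q))"
        using s \<open>C > 0\<close> by (intro epowr_ennreal) (auto simp: A_def y_def)
      finally show ?thesis .
    qed
    moreover have "A \<ge> 0" "min (\<sigma> / k) (1 / (k * q)) > 0"
      using \<sigma> k kq by (auto simp: A_def)
    ultimately show ?thesis unfolding y_def by blast
  qed
  ultimately show ?thesis by blast
qed

end

section \<open>Calderon-Lozanovskii norms and the upper limit\<close>

lemma calderon_lozanovskii_lower: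
  assumes "u \<in> fspace NX" "v \<in> fspace NY"
    and "AE x in lebesgue. \<bar>h x\<bar> \<le> \<bar>u x\<bar> powr (1 - s) * \<bar>v x\<bar> powr s"
  shows "calderon_lozanovskii s NX NY h \<le> epowr (NX u) (1 - s) * epowr (NY v) s"
  unfolding calderon_lozanovskii_def by (rule Inf_lower) (use assms in blast)

lemma calderon_lozanovskii_greatest:
  assumes "\<And>u v. \<lbrakk>u \<in> fspace NX; v \<in> fspace NY;
      AE x in lebesgue. \<bar>h x\<bar> \<le> \<bar>u x\<bar> powr (1 - s) * \<bar>v x\<bar> powr s\<rbrakk>
    \<Longrightarrow> B \<le> epowr (NX u) (1 - s) * epowr (NY v) s"
  shows "B \<le> calderon_lozanovskii s NX NY h"
  unfolding calderon_lozanovskii_def by (rule Inf_greatest) (use assms in blast)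

text \<open>The pair \<open>(h, h)\<close> is admissible, since the exponents add up to 1.\<close>

lemma calderon_lozanovskii_le:
  assumes "h \<in> fspace NX" "h \<in> fspace NY"
  shows "calderon_lozanovskii s NX NY h \<le> epowr (NX h) (1 - s) * epowr (NY h) s"
  by (rule calderon_lozanovskii_lower) (use assms in \<open>simp_all flip: powr_add\<close>)

lemma Limsup_calderon_lozanovskii_le:
  fixes X Y :: "('a::euclidean_space) fnorm" and D :: "real \<Rightarrow> 'a \<Rightarrow> ennreal"
  assumes D [measurable]: "\<And>s. D s \<in> borel_measurable lebesgue" and q: "q > 0"
    and nonneg: "A1 \<ge> 0" "B1 \<ge> 0" "A2 \<ge> 0" "B2 \<ge> 0"
    and X: "\<forall>\<^sub>F s in at_right 0. ennreal (s powr (1 / q)) * ext_norm X (D s) \<le> ennreal ((A1 * s + B1) powr (1 / q))"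
    and Y: "\<forall>\<^sub>F s in at_right 0. ennreal (s powr (1 / q)) * ext_norm Y (D s) \<le> ennreal ((A2 * s + B2) powr (1 / q))"
  shows "Limsup (at_right 0) (\<lambda>s. ennreal (s powr (1 / q)) * ext_norm (calderon_lozanovskii s X Y) (D s))
    \<le> ennreal (B1 powr (1 / q))"
proof -
  define U where "U s = (A1 * s + B1) powr (1 / q)" for s
  \<comment> \<open>For \<open>s < 1\<close> this dominates the whole bound for \<open>Y\<close>.
    The summand 1 keeps it positive, so that \<open>W powr s\<close> tends to 1.\<close>
  define W where "W = (A2 + B2 + 1) powr (1 / q)"
  have W: "W > 0" using nonneg by (simp add: W_def)
  have "\<forall>\<^sub>F s in at_right (0::real). 0 < s \<and> s < 1"
    by (rule eventually_at_rightI[of 0 1]) auto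
  then have ev: "\<forall>\<^sub>F s in at_right 0. ennreal (s powr (1 / q)) * ext_norm (calderon_lozanovskii s X Y) (D s)
      \<le> ennreal (U s powr (1 - s) * W powr s)"
    using X Y
  proof eventually_elim
    case (elim s)
    then have s: "0 < s" "s < 1" by auto
    define c where "c = s powr (1 / q)"
    have c: "c > 0" using s by (simp add: c_def)
    have "A2 * s \<le> A2 * 1" using s nonneg by (intro mult_left_mono) auto
    then have "ennreal ((A2 * s + B2) powr (1 / q)) \<le> ennreal W"
      unfolding W_def using s nonneg q by (intro ennreal_leI powr_mono2) auto
    with elim have cY: "ennreal c * ext_norm Y (D s) \<le> ennreal W"
      unfolding c_def by (rule_tac order.trans) auto
    have cX: "ennreal c * ext_norm X (D s) \<le> ennreal (U s)"
      using elim by (simp add: c_def U_def)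
    have "ennreal c * ext_norm X (D s) < \<infinity>" "ennreal c * ext_norm Y (D s) < \<infinity>"
      using le_less_trans[OF cX] le_less_trans[OF cY] by auto
    then have fin: "ext_norm X (D s) < \<infinity>" "ext_norm Y (D s) < \<infinity>"
      using c by (auto simp: ennreal_mult_less_top)
    define h where "h x = enn2real (D s x)" for x
    from fin have AE: "AE x in lebesgue. D s x < \<infinity>" and Xh: "ext_norm X (D s) = X h" and Yh: "ext_norm Y (D s) = Y h"
      by (auto simp: ext_norm_def h_def[abs_def] split: if_splits)
    have "h \<in> fspace X" "h \<in> fspace Y"
      using fin by (auto simp: fspace_def L0_def Xh Yh) (simp_all add: h_def[abs_def])
    then have "ext_norm (calderon_lozanovskii s X Y) (D s) \<le> epowr (X h) (1 - s) * epowr (Y h) s"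
      using AE calderon_lozanovskii_le[of h X Y s] by (simp add: ext_norm_def h_def[abs_def])
    then have "ennreal c * ext_norm (calderon_lozanovskii s X Y) (D s)
        \<le> ennreal c * (epowr (X h) (1 - s) * epowr (Y h) s)"
      by (rule mult_left_mono) simp
    \<comment> \<open>The factor \<open>c\<close> is shared out as
      \<open>c powr (1 - s) * c powr s\<close>, so that each norm receives its own
      normalisation.\<close>
    also have "\<dots> = epowr (ennreal c * X h) (1 - s) * epowr (ennreal c * Y h) s"
    proof -
      have "ennreal c = ennreal (c powr (1 - s)) * ennreal (c powr s)"
        using c by (simp flip: ennreal_mult powr_add)
      then have "ennreal c * (epowr (X h) (1 - s) * epowr (Y h) s)
          = (ennreal (c powr (1 - s)) * epowr (X h) (1 - s)) * (ennreal (c powr s) * epowr (Y h) s)"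
        by (simp only: mult_ac)
      then show ?thesis
        using c by (simp only: epowr_mult less_imp_le)
    qed
    also have "\<dots> \<le> epowr (ennreal (U s)) (1 - s) * epowr (ennreal W) s"
      using cX cY s by (intro mult_mono epowr_mono) (auto simp: Xh Yh)
    also have "\<dots> = ennreal (U s powr (1 - s) * W powr s)"
      using W by (simp add: epowr_ennreal U_def ennreal_mult)
    finally show ?case by (simp add: c_def)
  qed
  have "((\<lambda>s. A1 * s + B1) \<longlongrightarrow> A1 * 0 + B1) (at_right 0)"
    by (intro tendsto_intros)
  then have U_lim: "(U \<longlongrightarrow> B1 powr (1 / q)) (at_right 0)"
    unfolding U_def[abs_def]
    by (intro tendsto_powr' tendsto_const)
      (use nonneg q in \<open>auto intro!: eventually_at_rightI[of 0 1]\<close>)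
  \<comment> \<open>\<open>B1\<close> may be 0, so continuity of the power is used in the form that
    admits base 0 when the exponent has a positive limit.\<close>
  have "((\<lambda>s. U s powr (1 - s)) \<longlongrightarrow> (B1 powr (1 / q)) powr (1 - 0)) (at_right 0)"
    by (intro tendsto_powr' U_lim tendsto_diff tendsto_const tendsto_ident_at disjI2 conjI always_eventually)
      (simp_all add: U_def)
  moreover have "((\<lambda>s. W powr s) \<longlongrightarrow> W powr 0) (at_right 0)"
    using W by (intro tendsto_intros) auto
  ultimately have "((\<lambda>s. ennreal (U s powr (1 - s) * W powr s)) \<longlongrightarrow> ennreal ((B1 powr (1 / q)) powr (1 - 0) * W powr 0)) (at_right 0)"
    by (intro tendsto_ennrealI tendsto_mult)
  then have "Limsup (at_right 0) (\<lambda>s. ennreal (U s powr (1 - s) * W powr s)) = ennreal (B1 powr (1 / q))"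
    using W by (intro lim_imp_Limsup) auto
  then show ?thesis
    using Limsup_mono[OF ev] by simp
qed

section \<open>The lower bound\<close>

text \<open>Young's inequality with second number 1; at \<open>a = 0\<close> the left side
  vanishes.\<close>

lemma powr_le_affine:
  fixes a s :: real
  assumes "0 \<le> a" "0 \<le> s" "s \<le> 1"
  shows "a powr (1 - s) \<le> (1 - s) * a + s"
proof (cases "a = 0")
  case False
  with Youngs_inequality_0[of "1 - s" s a 1] assms show ?thesis by simp
qed (use assms in simp)

text \<open>Dividing both members of a pair admissible for \<open>h\<close> by \<open>c\<close>
  gives a pair admissible for \<open>f\<close>, and the product of the norms is divided by
  \<open>c\<close> as well.\<close>

lemma calderon_lozanovskii_scale_mono:
  assumes "ball_banach_function_space X" "ball_banach_function_space Y" and c: "c > 0"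
    and le: "AE x in lebesgue. c * \<bar>f x\<bar> \<le> \<bar>h x\<bar>"
  shows "ennreal c * calderon_lozanovskii s X Y f \<le> calderon_lozanovskii s X Y h"
proof (rule calderon_lozanovskii_greatest)
  interpret X: ball_banach_function_space X by fact
  interpret Y: ball_banach_function_space Y by fact
  fix u v
  assume uv: "u \<in> fspace X" "v \<in> fspace Y" "AE x in lebesgue. \<bar>h x\<bar> \<le> \<bar>u x\<bar> powr (1 - s) * \<bar>v x\<bar> powr s"
  define u' where "u' = (\<lambda>x. (1 / c) * u x)"
  define v' where "v' = (\<lambda>x. (1 / c) * v x)"
  have Xu: "X u' = ennreal (1 / c) * X u" and Yv: "Y v' = ennreal (1 / c) * Y v"
    using X.norm_scale[OF uv(1), of "1 / c"] Y.norm_scale[OF uv(2), of "1 / c"] c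
    by (simp_all add: u'_def v'_def)
  have "u' \<in> fspace X" "v' \<in> fspace Y"
    using uv Xu Yv by (auto simp: fspace_def L0_def u'_def v'_def ennreal_mult_less_top)
  moreover have "AE x in lebesgue. \<bar>f x\<bar> \<le> \<bar>u' x\<bar> powr (1 - s) * \<bar>v' x\<bar> powr s"
    using uv(3) le
  proof eventually_elim
    case (elim x)
    have "\<bar>f x\<bar> \<le> (1 / c) * (\<bar>u x\<bar> powr (1 - s) * \<bar>v x\<bar> powr s)"
      using elim c by (simp add: field_simps)
    also have "1 / c = (1 / c) powr (1 - s) * (1 / c) powr s"
      using c by (simp flip: powr_add)
    finally show ?case
      using c by (simp add: u'_def v'_def abs_mult powr_mult powr_divide mult_ac)
  qed
  ultimately have "calderon_lozanovskii s X Y f \<le> epowr (X u') (1 - s) * epowr (Y v') s"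
    by (rule calderon_lozanovskii_lower)
  also have "\<dots> = (ennreal ((1 / c) powr (1 - s)) * ennreal ((1 / c) powr s)) * (epowr (X u) (1 - s) * epowr (Y v) s)"
  proof -
    have "epowr (X u') (1 - s) = ennreal ((1 / c) powr (1 - s)) * epowr (X u) (1 - s)"
      "epowr (Y v') s = ennreal ((1 / c) powr s) * epowr (Y v) s"
      unfolding Xu Yv using c by (auto intro!: epowr_mult)
    then show ?thesis by (simp only: mult_ac)
  qed
  also have "ennreal ((1 / c) powr (1 - s)) * ennreal ((1 / c) powr s) = ennreal (1 / c)"
    using c by (simp flip: ennreal_mult powr_add)
  finally have "ennreal c * calderon_lozanovskii s X Y f
      \<le> ennreal c * (ennreal (1 / c) * (epowr (X u) (1 - s) * epowr (Y v) s))"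
    by (intro mult_left_mono) auto
  also have "\<dots> = epowr (X u) (1 - s) * epowr (Y v) s"
    using c by (simp add: mult.assoc[symmetric] flip: ennreal_mult)
  finally show "ennreal c * calderon_lozanovskii s X Y f \<le> epowr (X u) (1 - s) * epowr (Y v) s" .
qed

text \<open>For \<open>x\<close> in the ball and \<open>norm h \<ge> 2 * R\<close> the points
  \<open>x + j h\<close> with \<open>j \<ge> 1\<close> lie outside the ball, so only the summand
  \<open>j = 0\<close> survives for almost every such \<open>h\<close>. The constant is the radial
  integral outside radius \<open>2 * R\<close>; off the ball the left side is 0.\<close>

lemma diff_energy_ge:
  fixes f :: "'a::euclidean_space \<Rightarrow> real"
  assumes supp: "AE x in lebesgue. x \<notin> ball 0 R \<longrightarrow> f x = 0" and R: "R > 0" and p: "\<sigma> * q > 0"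
  shows "AE x in lebesgue. ennreal (DIM('a) * unit_ball_vol DIM('a) * (2 * R) powr (- (\<sigma> * q)) / (\<sigma> * q))
    * ennreal (\<bar>f x\<bar> powr q) \<le> diff_energy \<sigma> k q f x"
  using supp
proof eventually_elim
  case (elim x)
  show ?case
  proof (cases "x \<in> ball 0 R")
    case True
    have [measurable]: "{h::'a. 2 * R \<le> norm h} \<in> sets borel" by measurable
    define n where "n = real DIM('a)"
    have "AE h in lborel. \<forall>j\<in>{1..k}. x + real j *\<^sub>R h \<notin> ball 0 R \<longrightarrow> f (x + real j *\<^sub>R h) = 0"
    proof (rule AE_finite_allI)
      fix j assume "j \<in> {1..k}"
      then show "AE h in lborel. x + real j *\<^sub>R h \<notin> ball 0 R \<longrightarrow> f (x + real j *\<^sub>R h) = 0"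
        using supp by (intro AE_lborel_scaleR) (auto simp: AE_completion_iff)
    qed simp
    then have fd: "AE h in lborel. 2 * R \<le> norm h \<longrightarrow> \<bar>fdiff k h f x\<bar> = \<bar>f x\<bar>"
    proof (eventually_elim, intro impI)
      fix h assume h: "\<forall>j\<in>{1..k}. x + real j *\<^sub>R h \<notin> ball 0 R \<longrightarrow> f (x + real j *\<^sub>R h) = 0"
        and "2 * R \<le> norm h"
      have "f (x + real j *\<^sub>R h) = 0" if "j \<in> {1..k}" for j
      proof -
        have "2 * R \<le> real j * norm h"
          using that \<open>2 * R \<le> norm h\<close> R mult_mono[of 1 "real j" "2 * R" "norm h"] by auto
        moreover have "norm (real j *\<^sub>R h) \<le> norm (x + real j *\<^sub>R h) + norm x"
          by (metis add_diff_cancel_left' norm_triangle_ineq4)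
        ultimately have "x + real j *\<^sub>R h \<notin> ball 0 R"
          using True by simp
        then show ?thesis using h that by blast
      qed
      then have "fdiff k h f x = (-1) ^ k * f x"
        by (simp add: fdiff_def sum.atLeast_Suc_atMost)
      then show "\<bar>fdiff k h f x\<bar> = \<bar>f x\<bar>" by (simp add: abs_mult power_abs)
    qed
    have "ennreal (n * unit_ball_vol n * (2 * R) powr (- (\<sigma> * q)) / (\<sigma> * q)) * ennreal (\<bar>f x\<bar> powr q)
        = (\<integral>\<^sup>+h. ennreal (1 / norm (h::'a) powr (n + \<sigma> * q)) * indicator {h. 2 * R \<le> norm h} h \<partial>lborel)
          * ennreal (\<bar>f x\<bar> powr q)"
      using nn_integral_norm_powr_outside_ball[of "2 * R" "\<sigma> * q", where 'a = 'a] R p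
      by (simp add: n_def)
    also have "\<dots> = (\<integral>\<^sup>+h. ennreal (1 / norm (h::'a) powr (n + \<sigma> * q)) * indicator {h. 2 * R \<le> norm h} h
        * ennreal (\<bar>f x\<bar> powr q) \<partial>lborel)"
      by (rule nn_integral_multc[symmetric]) measurable
    also have "\<dots> \<le> diff_energy \<sigma> k q f x"
      unfolding diff_energy_def n_def[symmetric]
    proof (rule nn_integral_mono_AE)
      show "AE h in lborel. ennreal (1 / norm h powr (n + \<sigma> * q)) * indicator {h. 2 * R \<le> norm h} h
          * ennreal (\<bar>f x\<bar> powr q) \<le> ennreal (\<bar>fdiff k h f x\<bar> powr q / norm h powr (n + \<sigma> * q))"
        using fd
      proof eventually_elim
        case (elim h)
        then show ?case
          by (cases "2 * R \<le> norm h") (simp_all add: ennreal_mult[symmetric])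
      qed
    qed
    finally show ?thesis by (simp add: n_def)
  qed (use elim in auto)
qed

text \<open>If \<open>\<bar>f\<bar> \<le> \<bar>g\<bar>\<^sup>1\<^sup>-\<^sup>s \<bar>h\<bar>\<^sup>s\<close>, then on a ball \<open>\<bar>h\<bar> \<le> 2^m Y h\<close> off a set of measure \<open>O(2^-m)\<close>. For
  \<open>s \<le> 1 / (m + 2)^2\<close> the factor \<open>2^(m s)\<close> tends to \<open>1\<close>, Young's inequality linearises the power of \<open>\<bar>g\<bar>\<close>,
  and by Borel--Cantelli the exceptional sets are negligible in the limit, so that the Fatou property
  bounds \<open>X f\<close>.\<close>

lemma eventually_less_calderon_lozanovskii:
  fixes X Y :: "('a::euclidean_space) fnorm"
  assumes X: "ball_banach_function_space X" and Y: "ball_banach_function_space Y"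
    and f: "f \<in> L0" and R: "R > 0"
    and supp: "AE x in lebesgue. x \<notin> ball 0 R \<longrightarrow> f x = 0" and a: "a < X f"
  shows "\<forall>\<^sub>F s in at_right 0. a < calderon_lozanovskii s X Y f"
proof (rule ccontr)
  interpret X: ball_banach_function_space X by fact
  interpret Y: ball_banach_function_space Y by fact
  assume neg: "\<not> (\<forall>\<^sub>F s in at_right 0. a < calderon_lozanovskii s X Y f)"
  \<comment> \<open>The gap between \<open>a\<close> and \<open>a0\<close> turns an infimum of at
    most \<open>a\<close> into an admissible pair with product strictly below the finite number
    \<open>a0\<close>.\<close>
  obtain a0 where a0: "a < a0" "a0 < X f" using dense[OF a] by blast
  then have "a0 < top" by (meson less_le_trans top_greatest)
  then obtain a' where a': "a0 = ennreal a'" "a' \<ge> 0" by (cases a0) auto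
  have small: "\<exists>s>0. s \<le> d \<and> calderon_lozanovskii s X Y f < ennreal a'" if d: "d > 0" for d :: real
  proof -
    have "\<not> (\<forall>s>0. s < d \<longrightarrow> a < calderon_lozanovskii s X Y f)"
      using neg d by (auto simp: eventually_at_right[of 0 "1::real", simplified])
    then obtain s where "0 < s" "s < d" "calderon_lozanovskii s X Y f \<le> a"
      by (auto simp: not_less)
    then show ?thesis using a0 a' by (intro exI[of _ s]) auto
  qed
  \<comment> \<open>The bound \<open>1 / (m + 2)^2\<close> makes both \<open>s\<close> and
    \<open>m * s\<close> at most \<open>1 / (m + 2)\<close>; the shift by 2 ensures
    \<open>s < 1\<close> already for \<open>m = 0\<close>.\<close>
  define Q where "Q m s g h \<longleftrightarrow> 0 < s \<and> s \<le> 1 / real (m + 2) ^ 2 \<and> g \<in> fspace X \<and> h \<in> fspace Y \<and>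
      (AE x in lebesgue. \<bar>f x\<bar> \<le> \<bar>g x\<bar> powr (1 - s) * \<bar>h x\<bar> powr s) \<and>
      epowr (X g) (1 - s) * epowr (Y h) s < ennreal a'" for m :: nat and s g h
  have "\<exists>s g h. Q m s g h" for m
  proof -
    obtain s where s: "0 < s" "s \<le> 1 / real (m + 2) ^ 2" "calderon_lozanovskii s X Y f < ennreal a'"
      using small[of "1 / real (m + 2) ^ 2"] by auto
    then obtain g h where gh: "g \<in> fspace X" "h \<in> fspace Y"
        "AE x in lebesgue. \<bar>f x\<bar> \<le> \<bar>g x\<bar> powr (1 - s) * \<bar>h x\<bar> powr s"
        "epowr (X g) (1 - s) * epowr (Y h) s < ennreal a'"
      using calderon_lozanovskii_greatest[of X Y f s "ennreal a'"] by (meson not_less)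
    have "Q m s g h" unfolding Q_def by (intro conjI s gh)
    then show ?thesis by blast
  qed
  then obtain s g h where "\<And>m. Q m (s m) (g m) (h m)"
    by metis
  then have s: "0 < s m" "s m \<le> 1 / real (m + 2) ^ 2"
    and g: "g m \<in> fspace X" and h: "h m \<in> fspace Y"
    and fgh: "AE x in lebesgue. \<bar>f x\<bar> \<le> \<bar>g m x\<bar> powr (1 - s m) * \<bar>h m x\<bar> powr s m"
    and prod: "epowr (X (g m)) (1 - s m) * epowr (Y (h m)) (s m) < ennreal a'" for m
    by (simp_all only: Q_def)
  have s1: "s m < 1" for m
  proof -
    have "1 / real (m + 2) ^ 2 \<le> 1 / 2 ^ 2"
      by (intro divide_left_mono power_mono) auto
    then have "s m \<le> 1 / 2 ^ 2" by (rule order.trans[OF s(2)])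
    then show ?thesis by simp
  qed
  define \<gamma> where "\<gamma> m = enn2real (X (g m))" for m
  define \<beta> where "\<beta> m = enn2real (Y (h m))" for m
  have X\<gamma>: "X (g m) = ennreal (\<gamma> m)" and Y\<beta>: "Y (h m) = ennreal (\<beta> m)" for m
    using g[of m] h[of m] by (auto simp: \<gamma>_def \<beta>_def fspace_def less_top)
  have [measurable]: "f \<in> borel_measurable lebesgue" "g m \<in> borel_measurable lebesgue"
    "h m \<in> borel_measurable lebesgue" for m
    using f g[of m] h[of m] by (auto simp: fspace_def L0_def)
  have not_zero: "\<not> (AE x in lebesgue. f x = 0)"
  proof
    assume "AE x in lebesgue. f x = 0"
    then have "X f = X (\<lambda>x. 0)"
      using f by (intro X.norm_cong) (auto simp: L0_def elim: eventually_mono)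
    then show False using a X.norm_const_zero by simp
  qed
  \<comment> \<open>A vanishing norm of either factor would force \<open>f = 0\<close> almost
    everywhere. Positivity permits division by both norms below.\<close>
  have \<gamma>: "\<gamma> m > 0" for m
  proof (rule ccontr)
    assume "\<not> \<gamma> m > 0"
    then have "X (g m) = 0" using X\<gamma>[of m] by (simp add: ennreal_neg)
    then have "AE x in lebesgue. g m x = 0"
      using g[of m] by (intro X.norm_zero) (auto simp: fspace_def)
    then have "AE x in lebesgue. f x = 0"
      using fgh[of m] by eventually_elim simp
    then show False using not_zero by simp
  qed
  have \<beta>: "\<beta> m > 0" for m
  proof (rule ccontr)
    assume "\<not> \<beta> m > 0"
    then have "Y (h m) = 0" using Y\<beta>[of m] by (simp add: ennreal_neg)
    then have "AE x in lebesgue. h m x = 0"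
      using h[of m] by (intro Y.norm_zero) (auto simp: fspace_def)
    then have "AE x in lebesgue. f x = 0"
      using fgh[of m] by eventually_elim simp
    then show False using not_zero by simp
  qed
  define b where "b = enn2real (X (indicator (ball 0 R)))"
  have Xb: "X (indicator (ball 0 R)) = ennreal b"
    using X.ball_mem[OF R, of 0] by (auto simp: b_def fspace_def less_top)
  have b: "b \<ge> 0" by (simp add: b_def)
  have [measurable]: "ball (0::'a) R \<in> sets lebesgue" by simp
  \<comment> \<open>Exceptional sets of Chebyshev type: the threshold is proportional to the norm of
    \<open>h m\<close>, so local integrability in \<open>Y\<close> bounds their measure by
    \<open>C / 2 ^ m\<close> with one \<open>C\<close> for all \<open>m\<close>.\<close>
  define A where "A m = {x \<in> ball 0 R. \<beta> m * 2 ^ m < \<bar>h m x\<bar>}" for m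
  have A_sets [measurable]: "A m \<in> sets lebesgue" for m
  proof -
    have "A m = ball 0 R \<inter> {x \<in> space lebesgue. \<beta> m * 2 ^ m < \<bar>h m x\<bar>}" by (auto simp: A_def)
    also have "\<dots> \<in> sets lebesgue" by measurable
    finally show ?thesis .
  qed
  obtain C :: real where C: "C > 0" "\<And>u. u \<in> fspace Y \<Longrightarrow>
      (\<integral>\<^sup>+x\<in>ball 0 R. ennreal \<bar>u x\<bar> \<partial>lebesgue) \<le> ennreal C * Y u"
    using Y.locally_integrable[OF R, of 0] by blast
  have emA: "emeasure lebesgue (A m) \<le> ennreal (C * (1 / 2) ^ m)" for m
  proof -
    have "ennreal (\<beta> m * 2 ^ m) * emeasure lebesgue (A m)
        = (\<integral>\<^sup>+x. ennreal (\<beta> m * 2 ^ m) * indicator (A m) x \<partial>lebesgue)"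
      by (simp add: nn_integral_cmult_indicator)
    also have "\<dots> \<le> (\<integral>\<^sup>+x\<in>ball 0 R. ennreal \<bar>h m x\<bar> \<partial>lebesgue)"
      by (rule nn_integral_mono) (auto simp: A_def indicator_def intro!: ennreal_leI)
    also have "\<dots> \<le> ennreal C * ennreal (\<beta> m)"
      using C(2)[OF h[of m]] by (simp add: Y\<beta>)
    also have "\<dots> = ennreal (C * \<beta> m)"
      using C(1) \<beta>[of m] by (simp add: ennreal_mult)
    finally have le: "ennreal (\<beta> m * 2 ^ m) * emeasure lebesgue (A m) \<le> ennreal (C * \<beta> m)" .
    have pos: "\<beta> m * 2 ^ m > 0" using \<beta>[of m] by simp
    have "emeasure lebesgue (A m) = ennreal (1 / (\<beta> m * 2 ^ m) * (\<beta> m * 2 ^ m)) * emeasure lebesgue (A m)"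
      using \<beta>[of m] by simp
    also have "\<dots> = ennreal (1 / (\<beta> m * 2 ^ m)) * (ennreal (\<beta> m * 2 ^ m) * emeasure lebesgue (A m))"
      using pos by (subst ennreal_mult) (auto simp: mult.assoc)
    also have "\<dots> \<le> ennreal (1 / (\<beta> m * 2 ^ m)) * ennreal (C * \<beta> m)"
      by (intro mult_left_mono le) simp
    also have "\<dots> = ennreal (1 / (\<beta> m * 2 ^ m) * (C * \<beta> m))"
      using C(1) \<beta>[of m] by (intro ennreal_mult[symmetric]) auto
    also have "1 / (\<beta> m * 2 ^ m) * (C * \<beta> m) = C * (1 / 2) ^ m"
      using \<beta>[of m] by (simp add: power_one_over)
    finally show ?thesis .
  qed
  have conv: "AE x in lebesgue. \<forall>\<^sub>F m in sequentially. x \<in> space lebesgue - A m"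
  proof (rule borel_cantelli_AE1)
    show "emeasure lebesgue (A m) < \<infinity>" for m
      using emA[of m] by (simp add: le_less_trans)
    have "measure lebesgue (A m) \<le> C * (1 / 2) ^ m" for m
      using emA[of m] C(1) by (simp add: measure_def enn2real_leI)
    then show "summable (\<lambda>m. measure lebesgue (A m))"
      by (intro summable_comparison_test'[OF summable_mult[OF summable_geometric], of "1 / 2" 0 _ C]) auto
  qed simp
  \<comment> \<open>All exceptional sets of index at least \<open>l\<close> are removed at once, so
    the estimates for every \<open>m \<ge> l\<close> apply to the single function
    \<open>F l\<close>.\<close>
  define F where "F l x = \<bar>f x\<bar> * indicator (\<Inter>m\<in>{l..}. - A m) x" for l x
  have F_meas: "F l \<in> L0" for l
  proof -
    have "(\<Inter>m\<in>{l..}. - A m) \<in> sets lebesgue"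
      by (intro sets.countable_INT') (auto intro: sets.compl_sets[of _ lebesgue, simplified] simp: Compl_in_sets_lebesgue)
    then show ?thesis unfolding F_def[abs_def] L0_def by measurable
  qed
  have bound: "X (F l) \<le> ennreal (a' * 2 powr (1 / real (m + 2)) * (1 + b / real (m + 2)))" if "l \<le> m" for l m
  proof -
    define K where "K = \<gamma> m powr (1 - s m) * \<beta> m powr s m * 2 powr (m * s m)"
    have K: "K \<ge> 0" by (simp add: K_def)
    \<comment> \<open>Young's inequality for \<open>\<bar>g m x\<bar> / \<gamma> m\<close> splits
      the bound: \<open>u\<close> carries the linear term and has norm \<open>K * (1 - s m)\<close>,
      \<open>v\<close> carries the constant term, restricted to the ball because \<open>f\<close>
      vanishes outside.\<close>
    define u where "u = (\<lambda>x. K * (1 - s m) / \<gamma> m * \<bar>g m x\<bar>)"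
    define v where "v = (\<lambda>x::'a. K * s m * indicator (ball 0 R) x)"
    have uv [measurable]: "u \<in> borel_measurable lebesgue" "v \<in> borel_measurable lebesgue"
      unfolding u_def v_def by measurable
    have "AE x in lebesgue. \<bar>F l x\<bar> \<le> \<bar>u x + v x\<bar>"
      using supp fgh[of m]
    proof eventually_elim
      case (elim x)
      have nonneg: "0 \<le> u x" "0 \<le> v x"
        using K s(1)[of m] s1[of m] \<gamma>[of m] by (auto simp: u_def v_def)
      show ?case
      proof (cases "x \<in> ball 0 R \<and> x \<notin> A m")
        case True
        then have "\<bar>h m x\<bar> \<le> \<beta> m * 2 ^ m" by (auto simp: A_def)
        have "\<bar>F l x\<bar> \<le> \<bar>f x\<bar>" by (auto simp: F_def indicator_def)
        also have "\<dots> \<le> \<bar>g m x\<bar> powr (1 - s m) * \<bar>h m x\<bar> powr s m" by (rule elim)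
        also have "\<dots> \<le> \<bar>g m x\<bar> powr (1 - s m) * (\<beta> m * 2 ^ m) powr s m"
          using \<open>\<bar>h m x\<bar> \<le> _\<close> s(1)[of m] by (intro mult_left_mono powr_mono2) auto
        also have "\<bar>g m x\<bar> powr (1 - s m) = \<gamma> m powr (1 - s m) * (\<bar>g m x\<bar> / \<gamma> m) powr (1 - s m)"
          using \<gamma>[of m] by (simp flip: powr_mult)
        also have "(\<beta> m * 2 ^ m) powr s m = \<beta> m powr s m * 2 powr (m * s m)"
          by (simp add: powr_mult powr_powr flip: powr_realpow)
        also have "\<gamma> m powr (1 - s m) * (\<bar>g m x\<bar> / \<gamma> m) powr (1 - s m) * (\<beta> m powr s m * 2 powr (m * s m))
            = K * (\<bar>g m x\<bar> / \<gamma> m) powr (1 - s m)"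
          by (simp add: K_def mult_ac)
        also have "\<dots> \<le> K * ((1 - s m) * (\<bar>g m x\<bar> / \<gamma> m) + s m)"
          using K s(1)[of m] s1[of m] \<gamma>[of m] by (intro mult_left_mono powr_le_affine) auto
        also have "\<dots> = u x + v x"
          using True by (simp add: u_def v_def algebra_simps)
        finally show ?thesis by simp
      next
        case False
        then have "F l x = 0" using elim(1) that by (auto simp: F_def indicator_def)
        then show ?thesis by simp
      qed
    qed
    then have "X (F l) \<le> X (\<lambda>x. u x + v x)"
      using F_meas[of l] by (intro X.norm_mono) (auto simp: L0_def)
    also have "\<dots> \<le> X u + X v"
      by (rule X.norm_add_L0) (auto simp: L0_def)
    also have "X u = ennreal (K * (1 - s m))"
    proof -
      have "X u = X (\<lambda>x. K * (1 - s m) / \<gamma> m * g m x)"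
        by (rule X.norm_cong) (auto simp: L0_def u_def abs_mult)
      also have "\<dots> = ennreal (K * (1 - s m) / \<gamma> m) * ennreal (\<gamma> m)"
        using X.norm_scale[OF g[of m], of "K * (1 - s m) / \<gamma> m"] K s1[of m] \<gamma>[of m]
        by (simp add: X\<gamma> abs_mult)
      also have "\<dots> = ennreal (K * (1 - s m))"
        using K s1[of m] \<gamma>[of m] by (simp flip: ennreal_mult)
      finally show ?thesis .
    qed
    also have "X v = ennreal (K * s m * b)"
      using X.norm_scale[OF X.ball_mem[OF R, of 0], of "K * s m"] K s(1)[of m] b
      by (simp add: Xb v_def abs_mult flip: ennreal_mult)
    also have "ennreal (K * (1 - s m)) + ennreal (K * s m * b) = ennreal (K * (1 - s m) + K * s m * b)"
      using K s(1)[of m] s1[of m] b by (subst ennreal_plus) auto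
    also have "\<dots> \<le> ennreal (a' * 2 powr (1 / real (m + 2)) * (1 + b / real (m + 2)))"
    proof (rule ennreal_leI)
      have sm: "s m \<le> 1 / real (m + 2)"
        by (rule order.trans[OF s(2)]) (simp add: power2_eq_square divide_simps)
      have "m * s m \<le> real (m + 2) * (1 / real (m + 2) ^ 2)"
        using s(1)[of m] s(2)[of m] by (intro mult_mono) auto
      then have ms: "m * s m \<le> 1 / real (m + 2)"
        by (simp add: power2_eq_square)
      have "ennreal (\<gamma> m powr (1 - s m) * \<beta> m powr s m) < ennreal a'"
        using prod[of m] \<gamma>[of m] \<beta>[of m] by (simp add: X\<gamma> Y\<beta> epowr_ennreal ennreal_mult)
      then have "\<gamma> m powr (1 - s m) * \<beta> m powr s m \<le> a'"
        by (simp add: ennreal_less_iff)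
      then have K_le: "K \<le> a' * 2 powr (1 / real (m + 2))"
        unfolding K_def using ms a' by (intro mult_mono powr_mono) auto
      have "K * (1 - s m) + K * s m * b = K * ((1 - s m) + s m * b)"
        by (simp add: algebra_simps)
      also have "\<dots> \<le> K * (1 + 1 / real (m + 2) * b)"
        using K s(1)[of m] sm b by (intro mult_left_mono add_mono mult_right_mono) auto
      also have "\<dots> \<le> a' * 2 powr (1 / real (m + 2)) * (1 + 1 / real (m + 2) * b)"
        using K_le b by (intro mult_right_mono) auto
      finally show "K * (1 - s m) + K * s m * b \<le> a' * 2 powr (1 / real (m + 2)) * (1 + b / real (m + 2))"
        by simp
    qed
    finally show ?thesis .
  qed
  have "(\<lambda>m. ennreal (a' * 2 powr (1 / real (m + 2)) * (1 + b / real (m + 2))))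
      \<longlonglongrightarrow> ennreal (a' * 2 powr 0 * (1 + 0))"
  proof (rule tendsto_ennrealI)
    have "(\<lambda>m. c / real (m + 2)) \<longlonglongrightarrow> 0" for c :: real
      using lim_const_over_n[of c] by (rule LIMSEQ_ignore_initial_segment)
    note lim = this
    show "(\<lambda>m. a' * 2 powr (1 / real (m + 2)) * (1 + b / real (m + 2))) \<longlonglongrightarrow> a' * 2 powr 0 * (1 + 0)"
      by (intro tendsto_intros lim) auto
  qed
  then have lim: "(\<lambda>m. ennreal (a' * 2 powr (1 / real (m + 2)) * (1 + b / real (m + 2)))) \<longlonglongrightarrow> ennreal a'"
    by simp
  \<comment> \<open>Here \<open>l\<close> is fixed and \<open>m\<close> tends to infinity.\<close>
  have F_le: "X (F l) \<le> ennreal a'" for l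
    by (rule LIMSEQ_le_const[OF lim]) (use bound in blast)
  have "(\<lambda>l. X (F l)) \<longlonglongrightarrow> X (\<lambda>x. \<bar>f x\<bar>)"
  proof (rule X.norm_Fatou[THEN conjunct2])
    show "AE x in lebesgue. (\<forall>l. 0 \<le> F l x) \<and> incseq (\<lambda>l. F l x) \<and> (\<lambda>l. F l x) \<longlonglongrightarrow> \<bar>f x\<bar>"
      using conv
    proof eventually_elim
      case (elim x)
      then obtain M where M: "\<And>m. m \<ge> M \<Longrightarrow> x \<notin> A m"
        by (auto simp: eventually_sequentially)
      have "\<forall>\<^sub>F l in sequentially. F l x = \<bar>f x\<bar>"
        unfolding eventually_sequentially using M by (intro exI[of _ M]) (auto simp: F_def indicator_def)
      then have "(\<lambda>l. F l x) \<longlonglongrightarrow> \<bar>f x\<bar>" by (rule tendsto_eventually)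
      moreover have "incseq (\<lambda>l. F l x)"
        by (auto simp: incseq_def F_def indicator_def)
      ultimately show ?case by (simp add: F_def)
    qed
  qed (use F_meas in \<open>auto simp: L0_def\<close>)
  then have "X (\<lambda>x. \<bar>f x\<bar>) \<le> ennreal a'"
    by (rule LIMSEQ_le_const2) (use F_le in auto)
  moreover have "X (\<lambda>x. \<bar>f x\<bar>) = X f"
    by (rule X.norm_cong) (auto simp: L0_def)
  ultimately show False
    using a0 a' by simp
qed

text \<open>Every \<open>y\<close> below the left side has to be exceeded eventually. The pointwise
  bound \<open>diff_energy_ge\<close> reduces this to the convergence of its constant and to
  \<open>eventually_less_calderon_lozanovskii\<close>.\<close>

lemma le_Liminf_calderon_lozanovskii:
  fixes X Y :: "('a::euclidean_space) fnorm"
  assumes X: "ball_banach_function_space X" and Y: "ball_banach_function_space Y"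
    and f: "f \<in> fspace X" and supp: "compactly_supported f" and q: "q \<ge> 1" and k: "k \<ge> 1"
  shows "ennreal ((1 / (real k * q) * sphere_measure (sphere (0::'a) 1)) powr (1 / q)) * X f
    \<le> Liminf (at_right 0) (\<lambda>s. ennreal (s powr (1 / q)) * ext_norm (calderon_lozanovskii s X Y) (frak_D s k q f))"
  unfolding le_Liminf_iff
proof (intro allI impI)
  have L0: "f \<in> L0" and Xf: "X f < \<infinity>" using f by (auto simp: fspace_def)
  have kq: "real k * q > 0" using k q by simp
  define S where "S = sphere_measure (sphere (0::'a) 1)"
  have S: "S > 0" by (simp add: S_def sphere_measure_unit)
  define c0 where "c0 = (1 / (real k * q) * S) powr (1 / q)"
  have c0: "c0 > 0" using S k q by (simp add: c0_def)
  define x where "x = enn2real (X f)"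
  have Xx: "X f = ennreal x" "x \<ge> 0" using Xf by (simp_all add: x_def less_top)
  obtain R where R: "R > 0" and R_supp: "AE x in lebesgue. x \<notin> ball 0 R \<longrightarrow> f x = 0"
  proof -
    obtain K where K: "compact K" "AE x in lebesgue. x \<notin> K \<longrightarrow> f x = 0"
      using supp by (auto simp: compactly_supported_def)
    obtain R where "R > 0" "K \<subseteq> ball 0 R"
      using bounded_subset_ballD[OF compact_imp_bounded[OF K(1)]] by blast
    moreover from K(2) have "AE x in lebesgue. x \<notin> ball 0 R \<longrightarrow> f x = 0"
      by eventually_elim (use \<open>K \<subseteq> ball 0 R\<close> in auto)
    ultimately show ?thesis using that by blast
  qed
  \<comment> \<open>The constant of \<open>diff_energy_ge\<close> at smoothness
    \<open>s * k\<close>, to the power \<open>1 / q\<close>. The factor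
    \<open>s powr (1 / q)\<close> cancels its pole at 0, and the power of \<open>2 * R\<close> tends
    to 1.\<close>
  define c where "c s = (S * (2 * R) powr (- (s * real k * q)) / (s * real k * q)) powr (1 / q)" for s
  have c_lim: "((\<lambda>s. s powr (1 / q) * c s) \<longlongrightarrow> c0) (at_right 0)"
  proof -
    have "((\<lambda>s. (1 / (real k * q) * S * (2 * R) powr (- (s * real k * q))) powr (1 / q))
        \<longlongrightarrow> (1 / (real k * q) * S * (2 * R) powr (- (0 * real k * q))) powr (1 / q)) (at_right 0)"
      using R S k q by (intro tendsto_intros) auto
    also have "(1 / (real k * q) * S * (2 * R) powr (- (0 * real k * q))) powr (1 / q) = c0"
      using R by (simp add: c0_def)
    finally show ?thesis
    proof (rule Lim_transform_eventually)
      show "\<forall>\<^sub>F s in at_right 0. (1 / (real k * q) * S * (2 * R) powr (- (s * real k * q))) powr (1 / q)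
          = s powr (1 / q) * c s"
      proof (rule eventually_at_rightI[of 0 1])
        fix s :: real assume "s \<in> {0<..<1}"
        then have "s > 0" by simp
        have "s powr (1 / q) * c s = (s * (S * (2 * R) powr (- (s * real k * q)) / (s * real k * q))) powr (1 / q)"
          unfolding c_def by (rule powr_mult[symmetric])
        also have "s * (S * (2 * R) powr (- (s * real k * q)) / (s * real k * q))
            = 1 / (real k * q) * S * (2 * R) powr (- (s * real k * q))"
          using \<open>s > 0\<close> by simp
        finally show "(1 / (real k * q) * S * (2 * R) powr (- (s * real k * q))) powr (1 / q)
          = s powr (1 / q) * c s" ..
      qed simp
    qed
  qed
  fix y assume "y < ennreal ((1 / (real k * q) * sphere_measure (sphere (0::'a) 1)) powr (1 / q)) * X f"
  then have y: "y < ennreal (c0 * x)"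
    using Xx c0 by (simp add: c0_def S_def ennreal_mult)
  then obtain y' where y': "y = ennreal y'" "y' \<ge> 0" "y' < c0 * x"
    by (cases y) (auto simp: ennreal_less_iff)
  have "x > 0" using y' c0 by (metis less_le_trans mult_le_0_iff not_less order_less_imp_le le_less_trans)
  \<comment> \<open>The midpoint leaves room on both sides: \<open>b < c0\<close> for the
    convergence of the constants, \<open>y' / b < x\<close> for the norm of
    \<open>f\<close>.\<close>
  define b where "b = (y' / x + c0) / 2"
  have "y' / x < c0" using y' \<open>x > 0\<close> by (simp add: divide_less_eq)
  then have b: "0 < b" "b < c0" "y' < b * x"
    using y' \<open>x > 0\<close> c0 by (auto simp: b_def field_simps intro: add_nonneg_pos)
  have "y' / b < x" using b by (simp add: divide_less_eq mult.commute)
  then have "\<forall>\<^sub>F s in at_right 0. ennreal (y' / b) < calderon_lozanovskii s X Y f"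
    using b y' Xx by (intro eventually_less_calderon_lozanovskii[OF X Y L0 R R_supp]) (simp add: ennreal_less_iff)
  moreover have "\<forall>\<^sub>F s in at_right 0. b < s powr (1 / q) * c s"
    using c_lim b(2) by (rule order_tendstoD)
  moreover have "\<forall>\<^sub>F s in at_right (0::real). 0 < s"
    by (rule eventually_at_rightI[of 0 1]) auto
  ultimately show "\<forall>\<^sub>F s in at_right 0.
      y < ennreal (s powr (1 / q)) * ext_norm (calderon_lozanovskii s X Y) (frak_D s k q f)"
  proof eventually_elim
    case (elim s)
    have skq: "s * real k * q > 0" using elim(3) kq by (simp add: mult.assoc)
    have "S * (2 * R) powr (- (s * real k * q)) / (s * real k * q) > 0"
      using S R by (intro divide_pos_pos mult_pos_pos skq) auto
    then have c: "c s > 0" unfolding c_def powr_gt_zero by (rule less_imp_neq[symmetric])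
    have energy: "AE x in lebesgue. ennreal (c s * \<bar>f x\<bar>) \<le> frak_D s k q f x"
      using diff_energy_ge[OF R_supp R skq, of k]
    proof eventually_elim
      case (elim x)
      define e where "e = S * (2 * R) powr (- (s * real k * q)) / (s * real k * q)"
      have ce: "c s = e powr (1 / q)" unfolding c_def e_def ..
      have e: "e \<ge> 0" unfolding e_def using S by (intro divide_nonneg_pos skq) auto
      have "ennreal (c s * \<bar>f x\<bar>) = epowr (ennreal (e * \<bar>f x\<bar> powr q)) (1 / q)"
        using e q by (simp add: epowr_ennreal ce powr_mult powr_powr)
      also have "\<dots> \<le> epowr (diff_energy (s * real k) k q f x) (1 / q)"
      proof (rule epowr_mono)
        show "ennreal (e * \<bar>f x\<bar> powr q) \<le> diff_energy (s * real k) k q f x"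
          unfolding ennreal_mult[OF e powr_ge_zero] using elim by (simp only: e_def S_def sphere_measure_unit)
      qed (use q in simp)
      finally show ?case by (simp add: frak_D_eq)
    qed
    have "ennreal (c s) * calderon_lozanovskii s X Y f \<le> ext_norm (calderon_lozanovskii s X Y) (frak_D s k q f)"
    proof (cases "AE x in lebesgue. frak_D s k q f x < \<infinity>")
      case True
      have "AE x in lebesgue. c s * \<bar>f x\<bar> \<le> \<bar>enn2real (frak_D s k q f x)\<bar>"
        using True energy
      proof eventually_elim
        case (elim x)
        then show ?case
          using enn2real_mono[OF elim(2)] c by simp
      qed
      from calderon_lozanovskii_scale_mono[OF X Y c this] show ?thesis
        using True by (simp add: ext_norm_def)
    qed (simp add: ext_norm_def)
    then have le: "ennreal (s powr (1 / q)) * (ennreal (c s) * calderon_lozanovskii s X Y f)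
        \<le> ennreal (s powr (1 / q)) * ext_norm (calderon_lozanovskii s X Y) (frak_D s k q f)"
      by (rule mult_left_mono) simp
    have "y = ennreal b * ennreal (y' / b)"
      using b y' by (simp flip: ennreal_mult)
    also have "\<dots> < ennreal b * calderon_lozanovskii s X Y f"
      using elim(1) b by (intro ennreal_mult_strict_left_mono) auto
    also have "\<dots> \<le> ennreal (s powr (1 / q) * c s) * calderon_lozanovskii s X Y f"
      using elim(2) by (intro mult_right_mono ennreal_leI) auto
    also have "\<dots> = ennreal (s powr (1 / q)) * (ennreal (c s) * calderon_lozanovskii s X Y f)"
      using c by (simp add: ennreal_mult mult.assoc)
    finally show ?case using le by (rule less_le_trans)
  qed
qed

theorem theorem1p7:
  fixes X Y :: "('a::euclidean_space) fnorm" and k :: nat and q :: real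
  assumes "k \<ge> 1" and "q \<ge> 1"
    and "ball_banach_function_space X" and "ball_banach_function_space Y"
    and "ball_banach_function_space (convexification (1 / q) X)"
    and "ball_banach_function_space (convexification (1 / q) Y)"
    and "ball_averages_uniformly_bounded (convexification (1 / q) X)"
    and "ball_averages_uniformly_bounded (convexification (1 / q) Y)"
  shows "\<exists>C::real. C > 0 \<and>
    (\<forall>f \<in> (\<Union>\<sigma>\<in>{0<..<real k}. F_space X \<sigma> k q) \<inter> (\<Union>\<sigma>\<in>{0<..<real k}. F_space Y \<sigma> k q).
      compactly_supported f \<longrightarrow>
        ennreal ((1 / (real k * q) * sphere_measure (sphere (0::'a) 1)) powr (1 / q)) * X f
          \<le> Liminf (at_right 0) (\<lambda>s::real. ennreal (s powr (1 / q)) *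
                ext_norm (calderon_lozanovskii s X Y) (frak_D s k q f)) \<and>
        Liminf (at_right 0) (\<lambda>s::real. ennreal (s powr (1 / q)) *
                ext_norm (calderon_lozanovskii s X Y) (frak_D s k q f))
          \<le> Limsup (at_right 0) (\<lambda>s::real. ennreal (s powr (1 / q)) *
                ext_norm (calderon_lozanovskii s X Y) (frak_D s k q f)) \<and>
        Limsup (at_right 0) (\<lambda>s::real. ennreal (s powr (1 / q)) *
                ext_norm (calderon_lozanovskii s X Y) (frak_D s k q f))
          \<le> ennreal C * X f)"
proof -
  obtain C1 where C1: "C1 > 0" and bdX: "\<And>\<sigma> f. \<sigma> > 0 \<Longrightarrow> f \<in> F_space X \<sigma> k q \<Longrightarrow>
      \<exists>A\<ge>0. \<exists>s0>0. \<forall>s. 0 < s \<longrightarrow> s < s0 \<longrightarrow> ennreal (s powr (1 / q)) * ext_norm X (frak_D s k q f)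
      \<le> ennreal ((A * s + C1 * enn2real (X f) powr q) powr (1 / q))"
    using ball_banach_function_space.ext_norm_frak_D_le[OF assms(3) assms(5) assms(7) assms(2) assms(1)] by blast
  obtain C2 where C2: "C2 > 0" and bdY: "\<And>\<sigma> f. \<sigma> > 0 \<Longrightarrow> f \<in> F_space Y \<sigma> k q \<Longrightarrow>
      \<exists>A\<ge>0. \<exists>s0>0. \<forall>s. 0 < s \<longrightarrow> s < s0 \<longrightarrow> ennreal (s powr (1 / q)) * ext_norm Y (frak_D s k q f)
      \<le> ennreal ((A * s + C2 * enn2real (Y f) powr q) powr (1 / q))"
    using ball_banach_function_space.ext_norm_frak_D_le[OF assms(4) assms(6) assms(8) assms(2) assms(1)] by blast
  show ?thesis
  \<comment> \<open>The constant comes from \<open>X\<close> alone: the bound for \<open>Y\<close>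
    is raised to the power \<open>s\<close> and disappears in the limit.\<close>
  proof (intro exI[of _ "C1 powr (1 / q)"] conjI ballI impI)
    fix f
    assume f: "f \<in> (\<Union>\<sigma>\<in>{0<..<real k}. F_space X \<sigma> k q) \<inter> (\<Union>\<sigma>\<in>{0<..<real k}. F_space Y \<sigma> k q)"
      and supp: "compactly_supported f"
    then have fX: "f \<in> fspace X" by (auto simp: F_space_def)
    then have L0: "f \<in> L0" and Xf: "X f < \<infinity>" by (auto simp: fspace_def)
    obtain A1 s1 where 1: "A1 \<ge> 0" "s1 > 0"
      "\<And>s. 0 < s \<Longrightarrow> s < s1 \<Longrightarrow> ennreal (s powr (1 / q)) * ext_norm X (frak_D s k q f)
        \<le> ennreal ((A1 * s + C1 * enn2real (X f) powr q) powr (1 / q))"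
    proof -
      obtain \<sigma> where "\<sigma> > 0" "f \<in> F_space X \<sigma> k q" using f by auto
      from bdX[OF this] show ?thesis using that by blast
    qed
    obtain A2 s2 where 2: "A2 \<ge> 0" "s2 > 0"
      "\<And>s. 0 < s \<Longrightarrow> s < s2 \<Longrightarrow> ennreal (s powr (1 / q)) * ext_norm Y (frak_D s k q f)
        \<le> ennreal ((A2 * s + C2 * enn2real (Y f) powr q) powr (1 / q))"
    proof -
      obtain \<sigma> where "\<sigma> > 0" "f \<in> F_space Y \<sigma> k q" using f by auto
      from bdY[OF this] show ?thesis using that by blast
    qed
    have "Limsup (at_right 0) (\<lambda>s. ennreal (s powr (1 / q)) * ext_norm (calderon_lozanovskii s X Y) (frak_D s k q f))
        \<le> ennreal ((C1 * enn2real (X f) powr q) powr (1 / q))"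
    proof (rule Limsup_calderon_lozanovskii_le)
      show "\<forall>\<^sub>F s in at_right 0. ennreal (s powr (1 / q)) * ext_norm X (frak_D s k q f)
          \<le> ennreal ((A1 * s + C1 * enn2real (X f) powr q) powr (1 / q))"
        by (rule eventually_at_rightI[OF _ 1(2)]) (use 1(3) in auto)
      show "\<forall>\<^sub>F s in at_right 0. ennreal (s powr (1 / q)) * ext_norm Y (frak_D s k q f)
          \<le> ennreal ((A2 * s + C2 * enn2real (Y f) powr q) powr (1 / q))"
        by (rule eventually_at_rightI[OF _ 2(2)]) (use 2(3) in auto)
    qed (use 1 2 C1 C2 assms(2) L0 in \<open>auto intro: frak_D_measurable\<close>)
    also have "\<dots> = ennreal (C1 powr (1 / q)) * X f"
      using assms(2) Xf by (cases "X f") (auto simp: powr_mult powr_powr ennreal_mult)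
    finally show "Limsup (at_right 0) (\<lambda>s. ennreal (s powr (1 / q)) *
        ext_norm (calderon_lozanovskii s X Y) (frak_D s k q f)) \<le> ennreal (C1 powr (1 / q)) * X f" .
    show "ennreal ((1 / (real k * q) * sphere_measure (sphere (0::'a) 1)) powr (1 / q)) * X f
        \<le> Liminf (at_right 0) (\<lambda>s. ennreal (s powr (1 / q)) * ext_norm (calderon_lozanovskii s X Y) (frak_D s k q f))"
      by (rule le_Liminf_calderon_lozanovskii[OF assms(3,4) fX supp assms(2,1)])
  qed (use C1 in \<open>auto intro!: Liminf_le_Limsup\<close>)
qed

end
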